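(* Let $\mathcal{H}$ be a real Hilbert space, $t_0>0$, and let $\Phi,U:\mathcal{H}\to\mathbb{R}$, $\gamma,\varepsilon:[t_0,+\infty)\to(0,+\infty)$ satisfy the standing assumptions listed in the context. Assume that there exist $t_1\ge t_0$, $0\le\theta\le1$ and $\alpha>0$, with $\alpha>3$ if $\theta=1$, such that $$\gamma(t)\ge\frac{\alpha}{t^{\theta}}\ \text{ for every } t\ge t_1\qquad\text{and}\qquad\int_{t_0}^{+\infty}\left[\left(t^{\theta}\gamma(t)\right)'\right]^{+}dt<+\infty,$$ where $[a]^+=\max\{0,a\}$. Let $x\in C^2([t_0,+\infty);\mathcal{H})$ be a classical solution of $$x''(t)+\gamma(t)x'(t)+\nabla\Phi(x(t))+\varepsilon(t)\nabla U(x(t))=0,\qquad t\ge t_0.$$ Then the following two properties hold: (P$_1$) If $\int_{t_0}^{+\infty}t^{\theta}\varepsilon(t)\,dt<+\infty$, then $x(t)$ converges weakly in $\mathcal{H}$, as $t\to+\infty$, to some element of $S_\Phi$. (P$_2$) If $S_\Phi\cap S_U\neq\varnothing$ and $\liminf_{t\to+\infty}t^{1+\theta}\varepsilon(t)>0$, then $x(t)$ converges weakly in $\mathcal{H}$, as $t\to+\infty$, to some element of $S_\Phi\cap S_U$. Moreover, in both cases, the energy function $$W(t)=\tfrac12\|x'(t)\|^2+\Phi(x(t))-\Phi^{*}+\varepsilon(t)\,(U(x(t))-U^{*})$$ satisfies $$W(t)=o\!\left(1/t^{1+\theta}\right)\ (t\to+\infty)\qquad\text{and}\qquad\int_{t_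0}^{+\infty}t^{\theta}W(t)\,dt<+\infty.$$
   Context: $\mathcal{H}$ is a real Hilbert space with inner product $\langle\cdot,\cdot\rangle$ and norm $\|\cdot\|$; $t_0>0$ is fixed. Standing assumptions: (1) $\Phi,U:\mathcal{H}\to\mathbb{R}$ are convex, continuously differentiable and bounded from below; $\Phi^{*}=\inf_{\mathcal{H}}\Phi$, $U^{*}=\inf_{\mathcal{H}}U$. (2) The set $S_\Phi=\operatorname{argmin}\Phi=\{z\in\mathcal{H}:\Phi(z)=\Phi^{*}\}$ is nonempty. Likewise $S_U=\operatorname{argmin}U=\{z\in\mathcal{H}:U(z)=U^{*}\}$ (not assumed nonempty in general). (3) The gradients $\nabla\Phi$ and $\nabla U$ are Lipschitz on bounded subsets of $\mathcal{H}$. (4) $\gamma:[t_0,+\infty)\to(0,+\infty)$ is absolutely continuous and there exist $t_1'\ge t_0$ and constants $K_1,K_2>0$ such that $\gamma(t)\ge K_1/t$ and $\gamma'(t)\le K_2/t^2$ for almost every $t\ge t_1'$. (5) $\varepsilon:[t_0,+\infty)\to(0,+\infty)$ is absolutely continuous, nonincreasing, and $\lim_{t\to+\infty}\varepsilon(t)=0$. *)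

theory Defs
  imports "HOL-Analysis.Analysis" "HOL-Library.Landau_Symbols"
begin

text \<open>
  Absolute continuity (the usual \<open>\<epsilon>\<close>-\<open>\<delta>\<close> condition) on a set of reals, over finite families
  of compact, pairwise non-overlapping subintervals.
  A member \<open>k = {a..b}\<close> of a division has \<open>Inf k = a\<close> and \<open>Sup k = b\<close>.
\<close>

definition absolutely_continuous_fun_on ::
    "real set \<Rightarrow> (real \<Rightarrow> 'a::real_normed_vector) \<Rightarrow> bool" where
  "absolutely_continuous_fun_on S f \<longleftrightarrow>
     (\<forall>e>0. \<exists>d>0. \<forall>D T. D division_of T \<and> T \<subseteq> S \<and> (\<Sum>k\<in>D. Sup k - Inf k) < d \<longrightarrow>
        (\<Sum>k\<in>D. norm (f (Sup k) - f (Inf k))) < e)"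

text \<open>
  On an unbounded interval, absolute continuity is understood on every compact subinterval.
  (For the functions it is applied to, this agrees with the condition on the whole half-line:
  they are bounded below and the positive part of their derivative is integrable at infinity.)
\<close>

definition locally_absolutely_continuous_from :: "real \<Rightarrow> (real \<Rightarrow> 'a::real_normed_vector) \<Rightarrow> bool" where
  "locally_absolutely_continuous_from t0 f \<longleftrightarrow>
     (\<forall>T\<ge>t0. absolutely_continuous_fun_on {t0..T} f)"

definition argmin_set :: "('a \<Rightarrow> real) \<Rightarrow> 'a set" where
  "argmin_set f = {z. f z = (INF y. f y)}"

definition C1_gradient :: "('a::real_inner \<Rightarrow> real) \<Rightarrow> ('a \<Rightarrow> 'a) \<Rightarrow> bool" where
  "C1_gradient f g \<longleftrightarrow> (\<forall>z. GDERIV f z :> g z) \<and> continuous_on UNIV g"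

definition lipschitz_on_bounded_sets :: "('a::metric_space \<Rightarrow> 'b::metric_space) \<Rightarrow> bool" where
  "lipschitz_on_bounded_sets g \<longleftrightarrow> (\<forall>B. bounded B \<longrightarrow> (\<exists>L. L-lipschitz_on B g))"

text \<open>
  Weak convergence in a Hilbert space: every functional \<open>\<lambda>v. inner v y\<close>, hence by the Riesz
  theorem every continuous linear functional, converges along \<open>x\<close>.
\<close>

definition converges_weakly :: "(real \<Rightarrow> 'a::real_inner) \<Rightarrow> 'a \<Rightarrow> bool" where
  "converges_weakly x z \<longleftrightarrow> (\<forall>y. ((\<lambda>t. inner (x t) y) \<longlongrightarrow> inner z y) at_top)"

text \<open>The argument \<open>x'\<close> stands for the derivative of \<open>x\<close>.\<close>

definition energy ::
    "('a::real_inner \<Rightarrow> real) \<Rightarrow> ('a \<Rightarrow> real) \<Rightarrow> (real \<Rightarrow> real) \<Rightarrow>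
     (real \<Rightarrow> 'a) \<Rightarrow> (real \<Rightarrow> 'a) \<Rightarrow> real \<Rightarrow> real" where
  "energy \<Phi> U \<epsilon> x x' t =
     1 / 2 * (norm (x' t))\<^sup>2 + \<Phi> (x t) - (INF z. \<Phi> z) + \<epsilon> t * (U (x t) - (INF z. U z))"

end

theory Submission
  imports Defs
begin

text \<open>
  For \<open>z\<close> minimizing \<open>\<Phi>\<close> put \<open>h = \<parallel>x - z\<parallel>\<^sup>2 / 2\<close>. Convexity bounds \<open>h'' + \<gamma> h'\<close> by
  \<open>3/2 \<parallel>x'\<parallel>\<^sup>2 - W\<close> plus the remainder \<open>\<epsilon> (U z - inf U)\<close>, while \<open>W' \<le> - \<gamma> \<parallel>x'\<parallel>\<^sup>2\<close>. Hence, for a suitable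
  \<open>\<mu>\<close>, the function
  \<open>E = \<mu> t\<^bsup>1+\<theta>\<^esup> W + t\<^bsup>\<theta>\<^esup> h' + (t\<^bsup>\<theta>\<^esup> \<gamma> - \<theta> t\<^bsup>\<theta>-1\<^esup>) h\<close>
  satisfies \<open>E' \<le> \<omega> h - c t\<^bsup>\<theta>\<^esup> W\<close> up to the integrable remainder, with \<open>\<omega>\<close> integrable, and dominates
  \<open>t\<^bsup>1+\<theta>\<^esup> W + h\<close> up to a constant. So \<open>E\<close> is bounded and convergent, \<open>t\<^bsup>\<theta>\<^esup> W\<close> is integrable,
  \<open>t\<^bsup>1+\<theta>\<^esup> W\<close> tends to \<open>0\<close> because \<open>W\<close> is nonincreasing, and \<open>h\<close> converges; Opial's lemma then gives
  the weak limit. In the second case \<open>z\<close> also minimizes \<open>U\<close>, so the remainder vanishes, and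
  \<open>U(x) - inf U \<le> W / \<epsilon>\<close> tends to \<open>0\<close>.

  As \<open>\<gamma>\<close> and \<open>\<epsilon>\<close> need not be differentiable everywhere, every differential inequality \<open>F' \<le> b\<close> is replaced by the
  increment bound \<open>F(t) - F(s) \<le> \<integral> b\<close> over \<open>[s, t]\<close>.
\<close>

section \<open>Absolutely continuous functions\<close>

lemma absolutely_continuous_fun_on_subset:
  "absolutely_continuous_fun_on S f \<Longrightarrow> S' \<subseteq> S \<Longrightarrow> absolutely_continuous_fun_on S' f"
  unfolding absolutely_continuous_fun_on_def by (meson order_trans)

text \<open>Continuity at a point is the defining condition applied to a division with a single
  interval.\<close>

lemma absolutely_continuous_fun_on_imp_continuous_on:
  fixes f :: "real \<Rightarrow> 'a::real_normed_vector"
  assumes "absolutely_continuous_fun_on {a..b} f"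
  shows "continuous_on {a..b} f"
proof -
  have *: "\<exists>d>0. \<forall>y\<in>{a..b}. dist y x < d \<longrightarrow> dist (f y) (f x) < e"
    if x: "x \<in> {a..b}" and e: "e > 0" for x e
  proof -
    obtain d where d: "d > 0" and D: "\<And>D T. D division_of T \<Longrightarrow> T \<subseteq> {a..b} \<Longrightarrow>
        (\<Sum>k\<in>D. Sup k - Inf k) < d \<Longrightarrow> (\<Sum>k\<in>D. norm (f (Sup k) - f (Inf k))) < e"
      using assms e unfolding absolutely_continuous_fun_on_def by meson
    have "dist (f y) (f x) < e" if y: "y \<in> {a..b}" "dist y x < d" for y
    proof (cases "x \<le> y")
      case True
      have "{{x..y}} division_of {x..y}" using True division_of_self[of x y] by simp
      from D[OF this] show ?thesis using True x y by (auto simp: dist_norm)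
    next
      case False
      have "{{y..x}} division_of {y..x}" using False division_of_self[of y x] by simp
      from D[OF this] show ?thesis using False x y by (auto simp: dist_norm norm_minus_commute)
    qed
    with d show ?thesis by blast
  qed
  then show ?thesis unfolding continuous_on_iff by blast
qed

text \<open>In \<open>w v * f v - w u * f u = w v * (f v - f u) + f u * (w v - w u)\<close> the
  first part is controlled by the absolute continuity of \<open>f\<close>, the second by the total
  length of the division. With \<open>w\<close> a power of \<open>t\<close> this carries absolute
  continuity from \<open>\<gamma>\<close> to the weighted damping.\<close>

lemma absolutely_continuous_fun_on_lipschitz_mult:
  fixes f w :: "real \<Rightarrow> real"
  assumes f: "absolutely_continuous_fun_on {a..b} f" and w: "L-lipschitz_on {a..b} w"
  shows "absolutely_continuous_fun_on {a..b} (\<lambda>t. w t * f t)"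
proof -
  have "bounded (f ` {a..b})" "bounded (w ` {a..b})"
    using absolutely_continuous_fun_on_imp_continuous_on[OF f] lipschitz_on_continuous_on[OF w]
    by (auto intro: compact_imp_bounded compact_continuous_image)
  then obtain M N where M: "M > 0" "\<And>t. t \<in> {a..b} \<Longrightarrow> \<bar>f t\<bar> \<le> M"
    and N: "N > 0" "\<And>t. t \<in> {a..b} \<Longrightarrow> \<bar>w t\<bar> \<le> N"
    unfolding bounded_pos by fastforce
  have L: "L \<ge> 0" using w lipschitz_on_nonneg by blast
  show ?thesis unfolding absolutely_continuous_fun_on_def
  proof (intro allI impI)
    fix e :: real assume e: "e > 0"
    have "e / (2 * N) > 0" using e N by simp
    then obtain d where d: "d > 0" and D: "\<And>D T. D division_of T \<Longrightarrow> T \<subseteq> {a..b} \<Longrightarrow>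
        (\<Sum>k\<in>D. Sup k - Inf k) < d \<Longrightarrow> (\<Sum>k\<in>D. norm (f (Sup k) - f (Inf k))) < e / (2 * N)"
      using f unfolding absolutely_continuous_fun_on_def by meson
    show "\<exists>d>0. \<forall>D T. D division_of T \<and> T \<subseteq> {a..b} \<and> (\<Sum>k\<in>D. Sup k - Inf k) < d \<longrightarrow>
             (\<Sum>k\<in>D. norm (w (Sup k) * f (Sup k) - w (Inf k) * f (Inf k))) < e"
    \<comment> \<open>Each of the two parts may use \<open>e / 2\<close>: \<open>d\<close> was taken
      for \<open>e / (2 * N)\<close>, the other bound limits the total length. Writing
      \<open>L + 1\<close> keeps that bound positive when \<open>L = 0\<close>.\<close>
    proof (intro exI[of _ "min d (e / (2 * M * (L + 1)))"] conjI allI impI)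
      show "min d (e / (2 * M * (L + 1))) > 0" using d e M L by simp
      fix D T assume H: "D division_of T \<and> T \<subseteq> {a..b} \<and>
        (\<Sum>k\<in>D. Sup k - Inf k) < min d (e / (2 * M * (L + 1)))"
      have shape: "\<exists>u v. k = {u..v} \<and> u \<le> v \<and> u \<in> {a..b} \<and> v \<in> {a..b}" if k: "k \<in> D" for k
      proof -
        have "k \<noteq> {}" "k \<subseteq> {a..b}" using H k by blast+
        moreover obtain u v where "k = {u..v}" using H k division_ofD(4)[of D T k] by auto
        ultimately show ?thesis by auto
      qed
      have dv: "norm (w (Sup k) * f (Sup k) - w (Inf k) * f (Inf k)) \<le>
          N * norm (f (Sup k) - f (Inf k)) + M * L * (Sup k - Inf k)" if k: "k \<in> D" for k
      proof -
        obtain u v where uv: "k = {u..v}" "u \<le> v" and in': "u \<in> {a..b}" "v \<in> {a..b}"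
          using shape[OF k] by blast
        have "w v * f v - w u * f u = w v * (f v - f u) + f u * (w v - w u)" by (simp add: algebra_simps)
        also have "\<bar>\<dots>\<bar> \<le> \<bar>w v\<bar> * \<bar>f v - f u\<bar> + \<bar>f u\<bar> * \<bar>w v - w u\<bar>"
          by (metis abs_mult abs_triangle_ineq)
        also have "\<dots> \<le> N * \<bar>f v - f u\<bar> + M * (L * (v - u))"
          using M(2)[OF in'(1)] N(2)[OF in'(2)] lipschitz_onD[OF w in'(2,1)] uv(2) M(1) N(1)
          by (intro add_mono mult_mono) (auto simp: dist_real_def)
        finally show ?thesis using uv by simp
      qed
      have nn: "Sup k - Inf k \<ge> 0" if k: "k \<in> D" for k
        using shape[OF k] by auto
      have "(\<Sum>k\<in>D. norm (w (Sup k) * f (Sup k) - w (Inf k) * f (Inf k)))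
          \<le> N * (\<Sum>k\<in>D. norm (f (Sup k) - f (Inf k))) + M * L * (\<Sum>k\<in>D. Sup k - Inf k)"
        unfolding sum_distrib_left sum.distrib[symmetric] by (intro sum_mono dv)
      also have "\<dots> < N * (e / (2 * N)) + M * (L + 1) * (e / (2 * M * (L + 1)))"
      proof (intro add_less_le_mono mult_strict_left_mono mult_mono)
        show "(\<Sum>k\<in>D. norm (f (Sup k) - f (Inf k))) < e / (2 * N)"
          using D[of D T] H by simp
      qed (use H N M L nn in \<open>auto intro: sum_nonneg\<close>)
      also have "\<dots> = e"
      proof -
        have "N * (e / (2 * N)) = e / 2" using N(1) by simp
        moreover have "M * (L + 1) * (e / (2 * M * (L + 1))) = e / 2" using M(1) L by (simp add: divide_simps)
        ultimately show ?thesis by simp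
      qed
      finally show "(\<Sum>k\<in>D. norm (w (Sup k) * f (Sup k) - w (Inf k) * f (Inf k))) < e" .
    qed
  qed
qed

text \<open>A gauge proof: along a fine tagged division the tags in the exceptional null set
  contribute intervals of small total length, because the indicator of that set has
  gauge integral zero.\<close>

lemma absolutely_continuous_fun_on_increment_le:
  fixes f :: "real \<Rightarrow> real"
  assumes ab: "a \<le> b" and ac: "absolutely_continuous_fun_on {a..b} f"
    and N: "negligible N"
    and der: "\<And>t. t \<in> {a..b} - N \<Longrightarrow> \<exists>D. (f has_real_derivative D) (at t within {a..b}) \<and> D \<le> p t"
    and p: "p integrable_on {a..b}"
  shows "f b - f a \<le> integral {a..b} p"
proof (rule field_le_epsilon)
  fix e0 :: real assume e0: "e0 > 0"
  \<comment> \<open>The budget: one \<open>e\<close> for the tags in \<open>N\<close>, one for the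
    error of the Riemann sum, and \<open>e * (b - a)\<close> for the first-order errors at the
    remaining tags.\<close>
  define e where "e = e0 / (2 + (b - a))"
  have e: "e > 0" "e * (2 + (b - a)) = e0" using e0 ab unfolding e_def by (auto simp: add_pos_nonneg)
  define q where "q x = (if x \<in> N then 0 else p x)" for x
  have q: "(q has_integral integral {a..b} p) {a..b}"
    by (rule has_integral_spike[OF N _ integrable_integral[OF p]]) (simp add: q_def)
  have iN: "((indicator N :: real \<Rightarrow> real) has_integral 0) {a..b}"
    using N unfolding negligible_def box_real[symmetric] by blast
  obtain d where d: "d > 0" and D: "\<And>D T. D division_of T \<Longrightarrow> T \<subseteq> {a..b} \<Longrightarrow>
        (\<Sum>k\<in>D. Sup k - Inf k) < d \<Longrightarrow> (\<Sum>k\<in>D. norm (f (Sup k) - f (Inf k))) < e"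
    using ac e(1) unfolding absolutely_continuous_fun_on_def by meson
  obtain g1 where g1: "gauge g1" "\<And>D. D tagged_division_of {a..b} \<Longrightarrow> g1 fine D \<Longrightarrow>
      norm ((\<Sum>(x,k)\<in>D. measure lborel k *\<^sub>R q x) - integral {a..b} p) < e"
    using q e(1) unfolding has_integral_real by meson
  obtain g2 where g2: "gauge g2" "\<And>D. D tagged_division_of {a..b} \<Longrightarrow> g2 fine D \<Longrightarrow>
      norm ((\<Sum>(x,k)\<in>D. measure lborel k *\<^sub>R indicator N x) - (0::real)) < d"
    using iN d unfolding has_integral_real by meson
  \<comment> \<open>A straddle estimate: since \<open>u\<close> and \<open>v\<close> lie on opposite
    sides of \<open>t\<close>, the two first-order errors add up to
    \<open>e * (v - u)\<close>.\<close>
  have "\<exists>r>0. t \<in> {a..b} - N \<longrightarrow> (\<forall>u v. u \<in> {a..b} \<longrightarrow> v \<in> {a..b} \<longrightarrow> u \<le> t \<longrightarrow> t \<le> v \<longrightarrow>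
      t - u < r \<longrightarrow> v - t < r \<longrightarrow> f v - f u \<le> (p t + e) * (v - u))" for t
  proof (cases "t \<in> {a..b} - N")
    case True
    then obtain c where c: "(f has_real_derivative c) (at t within {a..b})" "c \<le> p t"
      using der by blast
    from c(1) obtain r where r: "r > 0" and R: "\<And>y. y \<in> {a..b} \<Longrightarrow> norm (y - t) < r \<Longrightarrow>
        norm (f y - f t - (y - t) *\<^sub>R c) \<le> e * norm (y - t)"
      unfolding has_real_derivative_iff_has_vector_derivative has_vector_derivative_def
        has_derivative_within_alt using e(1) by blast
    have "f v - f u \<le> (p t + e) * (v - u)" if h: "u \<in> {a..b}" "v \<in> {a..b}" "u \<le> t" "t \<le> v"
      "t - u < r" "v - t < r" for u v
    proof -
      have 1: "f v - f t - (v - t) * c \<le> e * (v - t)" using R[OF h(2)] h by auto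
      have 2: "- (f u - f t - (u - t) * c) \<le> e * (t - u)" using R[OF h(1)] h by auto
      have "f v - f u \<le> (c + e) * (v - u)" using 1 2 by (simp add: algebra_simps)
      also have "\<dots> \<le> (p t + e) * (v - u)" using c(2) h by (intro mult_right_mono) auto
      finally show ?thesis .
    qed
    with r show ?thesis by blast
  qed (auto intro: exI[of _ 1])
  then obtain r where r: "\<And>t. r t > 0" and R: "\<And>t u v. t \<in> {a..b} - N \<Longrightarrow> u \<in> {a..b} \<Longrightarrow>
      v \<in> {a..b} \<Longrightarrow> u \<le> t \<Longrightarrow> t \<le> v \<Longrightarrow> t - u < r t \<Longrightarrow> v - t < r t \<Longrightarrow> f v - f u \<le> (p t + e) * (v - u)"
    by metis
  have "gauge (\<lambda>t. ball t (r t))" using r by (simp add: gauge_ball_dependent)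
  then have "gauge (\<lambda>t. (g1 t \<inter> g2 t) \<inter> ball t (r t))" using g1 g2 by (simp add: gauge_Int)
  then obtain P where P: "P tagged_division_of {a..b}" "(\<lambda>t. (g1 t \<inter> g2 t) \<inter> ball t (r t)) fine P"
    using fine_division_exists_real by metis
  then have fine: "g1 fine P" "g2 fine P" "(\<lambda>t. ball t (r t)) fine P"
    by (simp_all add: fine_Int)
  note Pd = tagged_division_ofD[OF P(1)]
  have shape: "\<exists>u v. k = {u..v} \<and> u \<le> x \<and> x \<le> v \<and> u \<in> {a..b} \<and> v \<in> {a..b}" if xk: "(x,k) \<in> P" for x k
  proof -
    obtain u v where uv: "k = {u..v}" using Pd(4)[OF xk] by auto
    have "x \<in> k" "k \<subseteq> {a..b}" using Pd(2,3)[OF xk] by auto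
    with uv have "u \<le> x" "x \<le> v" "u \<in> {a..b}" "v \<in> {a..b}" by auto
    with uv show ?thesis by blast
  qed
  define Q where "Q = {(x,k) \<in> P. x \<in> N}"
  have finP: "finite P" and QP: "Q \<subseteq> P" and finQ: "finite Q"
    using Pd(1) by (auto simp: Q_def intro: rev_finite_subset)
  have contQ: "(\<Sum>(x,k)\<in>Q. measure lborel k) < d"
  proof -
    have "(\<Sum>(x,k)\<in>Q. measure lborel k) = (\<Sum>(x,k)\<in>P. measure lborel k *\<^sub>R indicator N x)"
      by (rule sum.mono_neutral_cong_left) (use QP finP in \<open>auto simp: Q_def indicator_def split: if_splits\<close>)
    also have "\<dots> < d" using g2(2)[OF P(1) fine(2)] by simp
    finally show ?thesis .
  qed
  \<comment> \<open>Absolute continuity speaks of a division, whereas \<open>Q\<close> consists of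
    tagged intervals. One interval can carry two tags only if it is degenerate, and there
    \<open>F\<close> vanishes.\<close>
  have sumQ: "(\<Sum>(x,k)\<in>Q. F k) = (\<Sum>k\<in>snd ` Q. F k)"
    if F: "\<And>u. F {u} = (0::real)" for F :: "real set \<Rightarrow> real"
  proof -
    have "sum F (snd ` Q) = sum (F \<circ> snd) Q"
    proof (rule sum.reindex_nontrivial[OF finQ])
      fix s t assume H: "s \<in> Q" "t \<in> Q" "s \<noteq> t" "snd s = snd t"
      obtain x k where s: "s = (x,k)" by force
      obtain y where t: "t = (y,k)" using H s by (metis snd_conv surj_pair)
      have xk: "(x,k) \<in> P" "(y,k) \<in> P" "(x,k) \<noteq> (y,k)" using H QP s t by auto
      have "interior k = {}" using Pd(5)[OF xk] by simp
      moreover obtain u v where "k = {u..v}" "u \<le> x" "x \<le> v" using shape[OF xk(1)] by blast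
      ultimately have "k = {u}" by (simp add: interior_atLeastAtMost_real)
      then show "F (snd s) = 0" using F s by simp
    qed
    then show ?thesis by (simp add: case_prod_beta comp_def)
  qed
  have len: "measure lborel k = Sup k - Inf k" if "(x,k) \<in> P" for x k using shape[OF that] by force
  have badsum: "(\<Sum>(x,k)\<in>Q. f (Sup k) - f (Inf k)) \<le> e"
  proof -
    have "Q tagged_partial_division_of {a..b}"
      using P(1) QP tagged_partial_division_subset unfolding tagged_division_of_def by blast
    from partial_division_of_tagged_division[OF this] have dv: "(snd ` Q) division_of \<Union>(snd ` Q)" .
    have sub: "\<Union>(snd ` Q) \<subseteq> {a..b}" using Pd(3) QP by force
    have "(\<Sum>k\<in>snd ` Q. Sup k - Inf k) = (\<Sum>(x,k)\<in>Q. Sup k - Inf k)"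
      by (rule sumQ[symmetric]) simp
    also have "\<dots> = (\<Sum>(x,k)\<in>Q. measure lborel k)"
      by (rule sum.cong) (use len QP in auto)
    also have "\<dots> < d" by (rule contQ)
    finally have "(\<Sum>k\<in>snd ` Q. norm (f (Sup k) - f (Inf k))) < e" by (rule D[OF dv sub])
    moreover have "(\<Sum>(x,k)\<in>Q. f (Sup k) - f (Inf k)) = (\<Sum>k\<in>snd ` Q. f (Sup k) - f (Inf k))"
      by (rule sumQ) simp
    moreover have "(\<Sum>k\<in>snd ` Q. f (Sup k) - f (Inf k)) \<le> (\<Sum>k\<in>snd ` Q. norm (f (Sup k) - f (Inf k)))"
      by (rule sum_mono) simp
    ultimately show ?thesis by linarith
  qed
  have good: "(case xk of (x,k) \<Rightarrow> f (Sup k) - f (Inf k)) \<le>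
      (case xk of (x,k) \<Rightarrow> measure lborel k *\<^sub>R q x + e * measure lborel k)" if xk: "xk \<in> P - Q" for xk
  proof -
    obtain x k where xk': "xk = (x,k)" by force
    then have xkP: "(x,k) \<in> P" "x \<notin> N" using xk by (auto simp: Q_def)
    obtain u v where k: "k = {u..v}" "u \<le> x" "x \<le> v" "u \<in> {a..b}" "v \<in> {a..b}"
      using shape[OF xkP(1)] by blast
    have "k \<subseteq> ball x (r x)" using fine(3) xkP(1) by blast
    moreover have "u \<in> k" "v \<in> k" using k by auto
    ultimately have "u \<in> ball x (r x)" "v \<in> ball x (r x)" by blast+
    then have "f v - f u \<le> (p x + e) * (v - u)"
      using k xkP by (intro R) (auto simp: dist_real_def)
    then show ?thesis using k xkP xk' by (simp add: q_def algebra_simps)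
  qed
  have "f b - f a = (\<Sum>(x,k)\<in>P. f (Sup k) - f (Inf k))"
    using additive_tagged_division_1[OF ab P(1), of f] by simp
  also have "\<dots> = (\<Sum>(x,k)\<in>P - Q. f (Sup k) - f (Inf k)) + (\<Sum>(x,k)\<in>Q. f (Sup k) - f (Inf k))"
    by (rule sum.subset_diff[OF QP finP])
  also have "\<dots> \<le> (\<Sum>(x,k)\<in>P - Q. measure lborel k *\<^sub>R q x + e * measure lborel k) + e"
    by (intro add_mono sum_mono good badsum)
  also have "(\<Sum>(x,k)\<in>P - Q. measure lborel k *\<^sub>R q x + e * measure lborel k) \<le>
      (\<Sum>(x,k)\<in>P. measure lborel k *\<^sub>R q x + e * measure lborel k)"
    by (rule sum_mono2) (use finP e(1) in \<open>auto simp: Q_def q_def\<close>)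
  also have "\<dots> = (\<Sum>(x,k)\<in>P. measure lborel k *\<^sub>R q x) + e * (\<Sum>(x,k)\<in>P. measure lborel k)"
    by (simp add: sum.distrib sum_distrib_left case_prod_beta)
  also have "(\<Sum>(x,k)\<in>P. measure lborel k) = b - a"
    using additive_content_tagged_division[of P a b] P(1) ab by simp
  also have "(\<Sum>(x,k)\<in>P. measure lborel k *\<^sub>R q x) \<le> integral {a..b} p + e"
    using g1(2)[OF P(1) fine(1)] by (simp add: abs_less_iff)
  finally have "f b - f a \<le> integral {a..b} p + e * (2 + (b - a))" by (simp add: algebra_simps)
  then show "f b - f a \<le> integral {a..b} p + e0" using e(2) by simp
qed

lemma locally_absolutely_continuous_imp_continuous_on:
  assumes "locally_absolutely_continuous_from t0 f"
  shows "continuous_on {t0..} f"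
proof (unfold continuous_on_eq_continuous_within, intro ballI)
  fix t assume t: "t \<in> {t0..}"
  have "continuous_on {t0..t + 1} f"
    using assms t unfolding locally_absolutely_continuous_from_def
    by (intro absolutely_continuous_fun_on_imp_continuous_on) auto
  then have "continuous (at t within {t0..t + 1}) f"
    using t by (auto simp: continuous_on_eq_continuous_within)
  moreover have "at t within {t0..t + 1} = at t within {t0..}"
    by (rule at_within_nhd[of t "{..<t + 1}"]) auto
  ultimately show "continuous (at t within {t0..}) f" by simp
qed

section \<open>Increments bounded by integrals\<close>

text \<open>This is the integrated form of \<open>F' \<le> b\<close>. Integrability is required in
  the absolute sense because it then survives multiplication by continuous functions, as in the
  product rule.\<close>

definition increment_le :: "real \<Rightarrow> (real \<Rightarrow> real) \<Rightarrow> (real \<Rightarrow> real) \<Rightarrow> bool" where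
  "increment_le T F b \<longleftrightarrow> (\<forall>s t. T \<le> s \<longrightarrow> s \<le> t \<longrightarrow>
     b absolutely_integrable_on {s..t} \<and> F t - F s \<le> integral {s..t} b)"

lemma increment_leI:
  assumes "\<And>s t. T \<le> s \<Longrightarrow> s \<le> t \<Longrightarrow> b absolutely_integrable_on {s..t}"
    and "\<And>s t. T \<le> s \<Longrightarrow> s \<le> t \<Longrightarrow> F t - F s \<le> integral {s..t} b"
  shows "increment_le T F b"
  using assms by (simp add: increment_le_def)

lemma increment_leD:
  assumes "increment_le T F b" "T \<le> s" "s \<le> t"
  shows "b absolutely_integrable_on {s..t}" "b integrable_on {s..t}" "F t - F s \<le> integral {s..t} b"
  using assms by (auto simp: increment_le_def intro: set_lebesgue_integral_eq_integral(1))

lemma increment_le_subset: "increment_le T F b \<Longrightarrow> T \<le> T' \<Longrightarrow> increment_le T' F b"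
  by (simp add: increment_le_def)

lemma increment_le_add:
  assumes "increment_le T F b" "increment_le T G c"
  shows "increment_le T (\<lambda>t. F t + G t) (\<lambda>t. b t + c t)"
proof (rule increment_leI)
  fix s t assume st: "T \<le> s" "s \<le> t"
  note f = increment_leD[OF assms(1) st] and g = increment_leD[OF assms(2) st]
  show "(\<lambda>t. b t + c t) absolutely_integrable_on {s..t}" using f(1) g(1) by (rule set_integral_add(1))
  show "F t + G t - (F s + G s) \<le> integral {s..t} (\<lambda>t. b t + c t)"
    using f(3) g(3) by (simp add: integral_add[OF f(2) g(2)])
qed

lemma increment_le_cmult:
  assumes "increment_le T F b" "c \<ge> 0"
  shows "increment_le T (\<lambda>t. c * F t) (\<lambda>t. c * b t)"
proof (rule increment_leI)
  fix s t assume st: "T \<le> s" "s \<le> t"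
  note f = increment_leD[OF assms(1) st]
  show "(\<lambda>t. c * b t) absolutely_integrable_on {s..t}" using f(1) by (rule set_integrable_mult_right)
  show "c * F t - c * F s \<le> integral {s..t} (\<lambda>t. c * b t)"
    using mult_left_mono[OF f(3) assms(2)] by (simp add: right_diff_distrib)
qed

lemma increment_le_mono:
  assumes "increment_le T F b"
    and "\<And>s t. T \<le> s \<Longrightarrow> s \<le> t \<Longrightarrow> c absolutely_integrable_on {s..t}"
    and le: "\<And>t. T \<le> t \<Longrightarrow> b t \<le> c t"
  shows "increment_le T F c"
proof (rule increment_leI)
  fix s t assume st: "T \<le> s" "s \<le> t"
  note f = increment_leD[OF assms(1) st]
  show c: "c absolutely_integrable_on {s..t}" by (rule assms(2)[OF st])
  have "integral {s..t} b \<le> integral {s..t} c"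
    using st le by (intro integral_le f set_lebesgue_integral_eq_integral(1)[OF c]) auto
  then show "F t - F s \<le> integral {s..t} c" using f(3) by simp
qed

lemma increment_le_cong:
  assumes "increment_le T F b" "\<And>t. T \<le> t \<Longrightarrow> F t = G t" "\<And>t. T \<le> t \<Longrightarrow> b t = c t"
  shows "increment_le T G c"
proof (rule increment_leI)
  fix s t assume st: "T \<le> s" "s \<le> t"
  note f = increment_leD[OF assms(1) st]
  show "c absolutely_integrable_on {s..t}"
    using f(1) assms(3) st absolutely_integrable_spike[OF f(1), of "{}" c] by auto
  show "G t - G s \<le> integral {s..t} c"
    using f(3) integral_cong[of "{s..t}" b c] assms(2,3) st by auto
qed

lemma increment_le_derivative:
  assumes der: "\<And>t. T \<le> t \<Longrightarrow> (F has_real_derivative b t) (at t within {T..})"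
    and cont: "continuous_on {T..} b"
  shows "increment_le T F b"
proof (rule increment_leI)
  fix s t assume st: "T \<le> s" "s \<le> t"
  show "b absolutely_integrable_on {s..t}"
    by (intro absolutely_integrable_continuous_real continuous_on_subset[OF cont]) (use st in auto)
  have "(b has_integral (F t - F s)) {s..t}"
  proof (rule fundamental_theorem_of_calculus[OF st(2)])
    fix r assume r: "r \<in> {s..t}"
    then have "(F has_real_derivative b r) (at r within {s..t})"
      using st by (intro DERIV_subset[OF der]) auto
    then show "(F has_vector_derivative b r) (at r within {s..t})"
      by (simp add: has_real_derivative_iff_has_vector_derivative)
  qed
  then show "F t - F s \<le> integral {s..t} b" by (simp add: integral_unique)
qed

lemma absolutely_integrable_continuous_mult:
  fixes p v :: "real \<Rightarrow> real"
  assumes p: "p absolutely_integrable_on {s..t}" and v: "continuous_on {s..t} v"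
  shows "(\<lambda>r. p r * v r) absolutely_integrable_on {s..t}"
proof -
  have "(\<lambda>r. v r * p r) absolutely_integrable_on {s..t}"
    by (rule absolutely_integrable_bounded_measurable_product_real[OF _ _ _ p])
      (use v in \<open>auto intro!: continuous_imp_measurable_on_sets_lebesgue compact_imp_bounded
         compact_continuous_image\<close>)
  then show ?thesis by (simp add: mult.commute)
qed

text \<open>Only continuity of \<open>\<phi>\<close> is available, so the product rule is obtained on short intervals up
  to an arbitrarily small error and then propagated by bisection.\<close>

lemma increment_le_mult:
  assumes phi: "increment_le T \<phi> p" and p0: "\<And>t. T \<le> t \<Longrightarrow> 0 \<le> p t"
    and cphi: "continuous_on {T..} \<phi>"
    and v0: "\<And>t. T \<le> t \<Longrightarrow> 0 \<le> v t"
    and der: "\<And>t. T \<le> t \<Longrightarrow> (v has_real_derivative v' t) (at t within {T..})"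
    and cv': "continuous_on {T..} v'"
  shows "increment_le T (\<lambda>t. \<phi> t * v t) (\<lambda>t. p t * v t + \<phi> t * v' t)"
proof (rule increment_leI)
  fix s t assume st: "T \<le> s" "s \<le> t"
  have sub: "{s..t} \<subseteq> {T..}" using st by auto
  have cv: "continuous_on {T..} v"
    using der by (intro DERIV_continuous_on[of _ v v']) auto
  note c = continuous_on_subset[OF cphi] continuous_on_subset[OF cv] continuous_on_subset[OF cv']
  have incv: "increment_le T v v'" by (rule increment_le_derivative[OF der cv'])
  \<comment> \<open>Together with \<open>incv\<close> this makes the increment of \<open>v\<close>
    equal to the integral of \<open>v'\<close>, so it may be multiplied by \<open>\<phi> u\<close>
    whatever its sign.\<close>
  have incv2: "increment_le T (\<lambda>t. - v t) (\<lambda>t. - v' t)"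
    by (rule increment_le_derivative) (auto intro!: derivative_intros der continuous_intros cv')
  \<comment> \<open>On an interval where \<open>\<phi>\<close> and \<open>v\<close> oscillate by at
    most \<open>e\<close>, freezing them at endpoints costs at most
    \<open>e * p + e * \<bar>v'\<bar>\<close>, that is, \<open>e\<close> times
    \<open>?B\<close>.\<close>
  let ?A = "\<lambda>t. p t * v t + \<phi> t * v' t" and ?B = "\<lambda>t. p t + \<bar>v' t\<bar>"
  have intA: "?A absolutely_integrable_on {u..w}" and intB: "?B absolutely_integrable_on {u..w}"
    if "T \<le> u" "u \<le> w" for u w
  proof -
    have sub': "{u..w} \<subseteq> {T..}" using that by auto
    note pi = increment_leD(1)[OF phi that]
    show "?A absolutely_integrable_on {u..w}"
      by (intro set_integral_add absolutely_integrable_continuous_mult pi c[OF sub']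
          absolutely_integrable_continuous_real continuous_intros)
    show "?B absolutely_integrable_on {u..w}"
      by (intro set_integral_add pi absolutely_integrable_continuous_real continuous_intros c[OF sub'])
  qed
  show "?A absolutely_integrable_on {s..t}" using intA st by simp
  note int = intA[THEN set_lebesgue_integral_eq_integral(1)] intB[THEN set_lebesgue_integral_eq_integral(1)]
  have approx: "\<phi> t * v t - \<phi> s * v s \<le> integral {s..t} ?A + e * integral {s..t} ?B" if e: "e > 0" for e
  proof -
    define P where "P u w \<longleftrightarrow> (s \<le> u \<longrightarrow> u \<le> w \<longrightarrow> w \<le> t \<longrightarrow>
      \<phi> w * v w - \<phi> u * v u \<le> integral {u..w} ?A + e * integral {u..w} ?B)" for u w
    have "P s t" using st(2)
    proof (induction rule: Bolzano)
      case (trans a b c)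
      show ?case unfolding P_def
      proof (intro impI)
        assume h: "s \<le> a" "a \<le> c" "c \<le> t"
        have "integral {a..b} ?A + integral {b..c} ?A = integral {a..c} ?A"
          and B: "integral {a..b} ?B + integral {b..c} ?B = integral {a..c} ?B"
          using h st trans by (auto intro!: Henstock_Kurzweil_Integration.integral_combine int)
        moreover have "e * integral {a..b} ?B + e * integral {b..c} ?B = e * integral {a..c} ?B"
          using B by (metis distrib_left)
        moreover have "\<phi> b * v b - \<phi> a * v a \<le> integral {a..b} ?A + e * integral {a..b} ?B"
          "\<phi> c * v c - \<phi> b * v b \<le> integral {b..c} ?A + e * integral {b..c} ?B"
          using trans h unfolding P_def by auto
        ultimately show "\<phi> c * v c - \<phi> a * v a \<le> integral {a..c} ?A + e * integral {a..c} ?B"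
          by linarith
      qed
    next
      case (local x)
      then have x: "x \<in> {s..t}" by simp
      obtain d1 where d1: "d1 > 0" "\<And>y. y \<in> {s..t} \<Longrightarrow> dist y x < d1 \<Longrightarrow> dist (\<phi> y) (\<phi> x) < e / 2"
        using c(1)[OF sub] x e unfolding continuous_on_iff by (meson half_gt_zero)
      obtain d2 where d2: "d2 > 0" "\<And>y. y \<in> {s..t} \<Longrightarrow> dist y x < d2 \<Longrightarrow> dist (v y) (v x) < e / 2"
        using c(2)[OF sub] x e unfolding continuous_on_iff by (meson half_gt_zero)
      show ?case
      proof (intro exI[of _ "min d1 d2"] conjI allI impI)
        show "min d1 d2 > 0" using d1 d2 by simp
        fix u w assume uw: "u \<le> x \<and> x \<le> w \<and> w - u < min d1 d2"
        show "P u w" unfolding P_def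
        proof (intro impI)
          assume h: "s \<le> u" "u \<le> w" "w \<le> t"
          have near: "\<bar>\<phi> u - \<phi> r\<bar> \<le> e" "\<bar>v w - v r\<bar> \<le> e" if r: "r \<in> {u..w}" for r
          proof -
            have close: "dist (\<phi> y) (\<phi> x) < e / 2" "dist (v y) (v x) < e / 2" if y: "y \<in> {u..w}" for y
            proof -
              have "y \<in> {s..t}" "dist y x < d1" "dist y x < d2"
                using y uw h by (auto simp: dist_real_def)
              then show "dist (\<phi> y) (\<phi> x) < e / 2" "dist (v y) (v x) < e / 2" using d1(2) d2(2) by auto
            qed
            show "\<bar>\<phi> u - \<phi> r\<bar> \<le> e"
              using close(1)[of u] close(1)[OF r] h(2) unfolding dist_real_def by simp argo
            show "\<bar>v w - v r\<bar> \<le> e"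
              using close(2)[of w] close(2)[OF r] h(2) unfolding dist_real_def by simp argo
          qed
          have Tu: "T \<le> u" "T \<le> w" using h st by auto
          note fp = increment_leD[OF phi Tu(1) h(2)]
            and fv = increment_leD[OF incv Tu(1) h(2)] and fv2 = increment_leD[OF incv2 Tu(1) h(2)]
          have veq: "v w - v u = integral {u..w} v'" using fv(3) fv2(3) by simp
          \<comment> \<open>\<open>v\<close> is frozen at the right end and \<open>\<phi>\<close> at
            the left end. The increment bound for \<open>\<phi>\<close> may be multiplied by
            \<open>v w\<close> because \<open>v w\<close> is nonnegative.\<close>
          have "\<phi> w * v w - \<phi> u * v u = (\<phi> w - \<phi> u) * v w + \<phi> u * (v w - v u)" by (simp add: algebra_simps)
          also have "\<dots> \<le> integral {u..w} p * v w + \<phi> u * integral {u..w} v'"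
            unfolding veq using fp(3) v0[OF Tu(2)] by (intro order_refl add_mono mult_right_mono) auto
          also have "\<dots> = integral {u..w} (\<lambda>r. p r * v w + \<phi> u * v' r)"
            by (subst integral_add) (auto intro!: integrable_on_mult_right integrable_on_mult_left fp(2) fv(2))
          also have "\<dots> \<le> integral {u..w} (\<lambda>r. ?A r + e * ?B r)"
          proof (rule integral_le)
            show "(\<lambda>r. p r * v w + \<phi> u * v' r) integrable_on {u..w}"
              by (intro integrable_add integrable_on_mult_right integrable_on_mult_left fp(2) fv(2))
            show "(\<lambda>r. ?A r + e * ?B r) integrable_on {u..w}"
              by (intro integrable_add[OF int(1)] integrable_on_mult_right int(2) Tu h)
            fix r assume r: "r \<in> {u..w}"
            have "p r * (v w - v r) \<le> p r * e"
              using near(2)[OF r] p0[of r] r Tu by (intro mult_left_mono) auto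
            moreover have "(\<phi> u - \<phi> r) * v' r \<le> e * \<bar>v' r\<bar>"
              using near(1)[OF r] by (metis abs_ge_self abs_ge_zero abs_mult mult_right_mono order_trans)
            ultimately show "p r * v w + \<phi> u * v' r \<le> ?A r + e * ?B r" by (simp add: algebra_simps)
          qed
          also have "\<dots> = integral {u..w} ?A + e * integral {u..w} ?B"
            by (subst integral_add) (auto intro!: int Tu h integrable_on_mult_right)
          finally show "\<phi> w * v w - \<phi> u * v u \<le> integral {u..w} ?A + e * integral {u..w} ?B" .
        qed
      qed
    qed
    then show ?thesis using st unfolding P_def by simp
  qed
  have B0: "integral {s..t} ?B \<ge> 0" using p0 st by (intro integral_nonneg int) auto
  show "\<phi> t * v t - \<phi> s * v s \<le> integral {s..t} ?A"
  proof (rule field_le_epsilon)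
    fix e :: real assume e: "e > 0"
    \<comment> \<open>Adding 1 in the denominator covers the case that the integral of
      \<open>?B\<close> is zero.\<close>
    have "\<phi> t * v t - \<phi> s * v s \<le> integral {s..t} ?A + e / (integral {s..t} ?B + 1) * integral {s..t} ?B"
      using e B0 by (intro approx) auto
    also have "e / (integral {s..t} ?B + 1) * integral {s..t} ?B \<le> e" using e B0 by (simp add: field_simps)
    finally show "\<phi> t * v t - \<phi> s * v s \<le> integral {s..t} ?A + e" by simp
  qed
qed

section \<open>Limits and integrability at infinity\<close>

lemma antimono_bounded_below_tendsto:
  fixes G :: "real \<Rightarrow> real"
  assumes mono: "\<And>s t. T \<le> s \<Longrightarrow> s \<le> t \<Longrightarrow> G t \<le> G s" and low: "\<And>t. T \<le> t \<Longrightarrow> m \<le> G t"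
  shows "\<exists>L. (G \<longlongrightarrow> L) at_top"
proof -
  have bb: "bdd_below (G ` {T..})" using low by (auto intro!: bdd_belowI[of _ m])
  have "(G \<longlongrightarrow> (INF t\<in>{T..}. G t)) at_top"
  proof (rule decreasing_tendsto)
    show "eventually (\<lambda>t. (INF t\<in>{T..}. G t) \<le> G t) at_top"
      using eventually_ge_at_top[of T] by eventually_elim (auto intro: cINF_lower[OF bb])
    fix y assume "(INF t\<in>{T..}. G t) < y"
    then obtain s where s: "s \<ge> T" "G s < y" using cINF_less_iff[OF _ bb] by auto
    show "eventually (\<lambda>t. G t < y) at_top"
      using eventually_ge_at_top[of s] by eventually_elim (use s mono in \<open>fastforce intro: le_less_trans\<close>)
  qed
  then show ?thesis by blast
qed

lemma absolutely_integrable_Ici_Icc: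
  fixes b :: "real \<Rightarrow> real"
  assumes "b absolutely_integrable_on {T..}" "T \<le> s"
  shows "b absolutely_integrable_on {s..t}"
  using assms by (auto intro: set_integrable_subset)

lemma integral_Icc_le_Ici:
  fixes b :: "real \<Rightarrow> real"
  assumes b: "b absolutely_integrable_on {T..}" and b0: "\<And>t. T \<le> t \<Longrightarrow> 0 \<le> b t" and s: "T \<le> s"
  shows "integral {s..t} b \<le> integral {T..} b"
  by (rule integral_subset_le)
    (use assms in \<open>auto intro: set_lebesgue_integral_eq_integral(1) absolutely_integrable_Ici_Icc\<close>)

lemma integral_tail_tendsto:
  fixes b :: "real \<Rightarrow> real"
  assumes b: "b absolutely_integrable_on {T..}" and b0: "\<And>t. T \<le> t \<Longrightarrow> 0 \<le> b t"
  shows "\<exists>L. ((\<lambda>t. integral {T..t} b) \<longlongrightarrow> L) at_top"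
proof -
  have int: "b integrable_on {s..t}" if "T \<le> s" for s t
    using absolutely_integrable_Ici_Icc[OF b that] by (rule set_lebesgue_integral_eq_integral(1))
  have "\<exists>L. ((\<lambda>t. - integral {T..t} b) \<longlongrightarrow> L) at_top"
  proof (rule antimono_bounded_below_tendsto[where T = T])
    show "- integral {T..t} b \<le> - integral {T..s} b" if "T \<le> s" "s \<le> t" for s t
      using that b0 by (auto intro!: integral_subset_le int)
    show "- integral {T..} b \<le> - integral {T..t} b" for t
      using integral_Icc_le_Ici[OF b b0, of T t] by simp
  qed
  then obtain L where "((\<lambda>t. - integral {T..t} b) \<longlongrightarrow> L) at_top" by blast
  from tendsto_minus[OF this] show ?thesis by auto
qed

lemma integral_small_tail:
  fixes b :: "real \<Rightarrow> real"
  assumes b: "b absolutely_integrable_on {T..}" and b0: "\<And>t. T \<le> t \<Longrightarrow> 0 \<le> b t" and e: "e > 0"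
  shows "\<exists>T'\<ge>T. \<forall>s t. T' \<le> s \<longrightarrow> s \<le> t \<longrightarrow> integral {s..t} b < e"
proof -
  obtain L where L: "((\<lambda>t. integral {T..t} b) \<longlongrightarrow> L) at_top" using integral_tail_tendsto[OF b b0] by blast
  obtain T0 where T0: "\<And>t. t \<ge> T0 \<Longrightarrow> dist (integral {T..t} b) L < e / 2"
    using tendstoD[OF L, of "e/2"] e by (auto simp: eventually_at_top_linorder)
  have "integral {s..t} b < e" if "max T T0 \<le> s" "s \<le> t" for s t
  proof -
    have "integral {T..s} b + integral {s..t} b = integral {T..t} b"
      using that absolutely_integrable_Ici_Icc[OF b, of T t]
      by (intro Henstock_Kurzweil_Integration.integral_combine set_lebesgue_integral_eq_integral(1)) auto
    then show ?thesis using T0[of s] T0[of t] that unfolding dist_real_def by linarith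
  qed
  then show ?thesis by (intro exI[of _ "max T T0"]) auto
qed

text \<open>Subtracting the running integral of \<open>b\<close> from \<open>F\<close> leaves a
  nonincreasing function that is bounded below, and the running integral itself converges.\<close>

lemma increment_le_tendsto:
  assumes F: "increment_le T F b" and low: "\<And>t. T \<le> t \<Longrightarrow> m \<le> F t"
    and b: "b absolutely_integrable_on {T..}" and b0: "\<And>t. T \<le> t \<Longrightarrow> 0 \<le> b t"
  shows "\<exists>L. (F \<longlongrightarrow> L) at_top"
proof -
  obtain L where L: "((\<lambda>t. integral {T..t} b) \<longlongrightarrow> L) at_top" using integral_tail_tendsto[OF b b0] by blast
  have "\<exists>L. ((\<lambda>t. F t - integral {T..t} b) \<longlongrightarrow> L) at_top"
  proof (rule antimono_bounded_below_tendsto[where T = T])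
    fix s t assume st: "T \<le> s" "s \<le> t"
    have "integral {T..s} b + integral {s..t} b = integral {T..t} b"
      using st absolutely_integrable_Ici_Icc[OF b, of T t]
      by (intro Henstock_Kurzweil_Integration.integral_combine set_lebesgue_integral_eq_integral(1)) auto
    then show "F t - integral {T..t} b \<le> F s - integral {T..s} b" using increment_leD(3)[OF F st] by linarith
  next
    show "m - integral {T..} b \<le> F t - integral {T..t} b" if "T \<le> t" for t
      using low[OF that] integral_Icc_le_Ici[OF b b0, of T t] by simp
  qed
  then obtain K where "((\<lambda>t. F t - integral {T..t} b) \<longlongrightarrow> K) at_top" by blast
  from tendsto_add[OF this L] show ?thesis by auto
qed

text \<open>The running integrals are nondecreasing and bounded, hence convergent, which for a
  nonnegative function is integrability on the half-line.\<close>

lemma absolutely_integrable_Ici_bounded: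
  fixes f :: "real \<Rightarrow> real"
  assumes cont: "continuous_on {T..} f" and f0: "\<And>t. T \<le> t \<Longrightarrow> 0 \<le> f t"
    and bound: "\<And>t. T \<le> t \<Longrightarrow> integral {T..t} f \<le> M"
  shows "f absolutely_integrable_on {T..}"
proof -
  have int: "f integrable_on {s..t}" if "T \<le> s" for s t
    by (intro integrable_continuous_interval continuous_on_subset[OF cont]) (use that in auto)
  have "\<exists>L. ((\<lambda>t. - integral {T..t} f) \<longlongrightarrow> L) at_top"
  proof (rule antimono_bounded_below_tendsto[where T = T])
    show "- integral {T..t} f \<le> - integral {T..s} f" if "T \<le> s" "s \<le> t" for s t
      using that f0 by (auto intro!: integral_subset_le int)
    show "- M \<le> - integral {T..t} f" if "T \<le> t" for t using bound[OF that] by simp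
  qed
  then obtain L where "((\<lambda>t. - integral {T..t} f) \<longlongrightarrow> L) at_top" by blast
  from tendsto_minus[OF this] have "((\<lambda>t. integral {T..t} f) \<longlongrightarrow> - L) at_top" by simp
  from has_integral_to_inf[OF int this f0] have "f integrable_on {T..}" by auto
  then show ?thesis using f0 by (intro nonnegative_absolutely_integrable_1) auto
qed

lemma absolutely_integrable_Ici_extend:
  fixes f :: "real \<Rightarrow> real"
  assumes cont: "continuous_on {T..} f" and f: "f absolutely_integrable_on {S..}"
  shows "f absolutely_integrable_on {T..}"
proof (cases "T \<le> S")
  case True
  have "f absolutely_integrable_on ({T..S} \<union> {S..})"
    by (intro set_integrable_Un f absolutely_integrable_continuous_real continuous_on_subset[OF cont]) auto
  moreover have "{T..S} \<union> {S..} = {T..}" using True by auto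
  ultimately show ?thesis by simp
next
  case False
  then show ?thesis by (intro set_integrable_subset[OF f]) auto
qed

text \<open>A Gronwall estimate: beyond the point where \<open>\<omega>\<close> has integral at most one half, the maximum
  of \<open>E\<close> absorbs the term \<open>\<omega> E\<close>.\<close>

lemma increment_le_gronwall_bounded:
  assumes E: "increment_le T E (\<lambda>t. r t + \<omega> t * E t)"
    and cE: "continuous_on {T..} E" and E0: "\<And>t. T \<le> t \<Longrightarrow> 0 \<le> E t"
    and r: "r absolutely_integrable_on {T..}" and r0: "\<And>t. T \<le> t \<Longrightarrow> 0 \<le> r t"
    and w: "\<omega> absolutely_integrable_on {T..}" and w0: "\<And>t. T \<le> t \<Longrightarrow> 0 \<le> \<omega> t"
  shows "\<exists>M. \<forall>t\<ge>T. E t \<le> M"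
proof -
  obtain S where S: "S \<ge> T" "\<And>s t. S \<le> s \<Longrightarrow> s \<le> t \<Longrightarrow> integral {s..t} \<omega> < 1/2"
    using integral_small_tail[OF w w0, of "1/2"] by auto
  \<comment> \<open>At a maximum point \<open>u\<close> the estimate reads
    \<open>E u \<le> E S + integral {T..} r + E u / 2\<close>; solving for \<open>E u\<close>
    produces the factor 2.\<close>
  define K where "K = 2 * (E S + integral {T..} r)"
  have late: "E t \<le> K" if t: "S \<le> t" for t
  proof -
    have "\<exists>u\<in>{S..t}. \<forall>y\<in>{S..t}. E y \<le> E u"
      using t S(1) by (intro continuous_attains_sup continuous_on_subset[OF cE]) auto
    then obtain u where u: "u \<in> {S..t}" "\<And>y. y \<in> {S..t} \<Longrightarrow> E y \<le> E u" by blast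
    have Su: "T \<le> S" "S \<le> u" using u S by auto
    have ri: "r integrable_on {S..u}" and wi: "\<omega> integrable_on {S..u}"
      using absolutely_integrable_Ici_Icc[OF r Su(1)] absolutely_integrable_Ici_Icc[OF w Su(1)]
      by (auto intro: set_lebesgue_integral_eq_integral(1))
    have "E u - E S \<le> integral {S..u} (\<lambda>t. r t + \<omega> t * E t)" by (rule increment_leD(3)[OF E Su])
    also have "\<dots> \<le> integral {S..u} (\<lambda>t. r t + \<omega> t * E u)"
      using u Su w0 by (intro integral_le increment_leD(2)[OF E Su] integrable_add ri
          integrable_on_mult_left wi add_left_mono mult_left_mono) auto
    also have "\<dots> = integral {S..u} r + integral {S..u} \<omega> * E u"
      by (subst integral_add) (auto intro!: ri integrable_on_mult_left wi)
    also have "\<dots> \<le> integral {T..} r + 1/2 * E u"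
      using S(2)[of S u] Su E0[of u] integral_Icc_le_Ici[OF r r0 Su(1), of u]
      by (intro add_mono mult_right_mono) auto
    finally have "E u \<le> K" unfolding K_def by simp
    then show ?thesis using u(2)[of t] t by auto
  qed
  have "compact (E ` {T..S})"
    by (intro compact_continuous_image continuous_on_subset[OF cE]) auto
  then obtain B where B: "\<And>y. y \<in> E ` {T..S} \<Longrightarrow> norm y \<le> B"
    using compact_imp_bounded bounded_iff by metis
  have "E t \<le> max K B" if "T \<le> t" for t
    using late[of t] B[of "E t"] that by (cases "S \<le> t") (auto simp: le_max_iff_disj)
  then show ?thesis by blast
qed

section \<open>Weak convergence\<close>

text \<open>Points of almost minimal norm in the sets \<open>C n\<close> form a Cauchy sequence by
  the parallelogram law, since the minimal squared norms increase to a finite limit; the limit point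
  lies in every \<open>C n\<close>.\<close>

lemma closed_convex_nested_Inter_nonempty:
  fixes C :: "nat \<Rightarrow> 'a::{real_inner, complete_space} set"
  assumes ne: "\<And>n. C n \<noteq> {}" and cl: "\<And>n. closed (C n)" and cv: "\<And>n. convex (C n)"
    and bd: "bounded (C 0)" and dec: "\<And>m n. m \<le> n \<Longrightarrow> C n \<subseteq> C m"
  shows "\<Inter> (range C) \<noteq> {}"
proof -
  define d where "d n = (INF v\<in>C n. (norm v)\<^sup>2)" for n
  obtain M where M: "\<And>v. v \<in> C 0 \<Longrightarrow> norm v \<le> M" using bd unfolding bounded_iff by blast
  have bb: "bdd_below ((\<lambda>v. (norm v)\<^sup>2) ` C n)" for n by (rule bdd_belowI[of _ 0]) auto
  have dle: "d n \<le> (norm v)\<^sup>2" if "v \<in> C n" for n v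
    unfolding d_def by (rule cINF_lower[OF bb that])
  have dmono: "d m \<le> d n" if "m \<le> n" for m n
    unfolding d_def by (rule cINF_superset_mono[OF ne bb dec[OF that]]) simp
  have dM: "d n \<le> M\<^sup>2" for n
  proof -
    obtain v where v: "v \<in> C n" using ne by blast
    then have "norm v \<le> M" using M dec[of 0 n] by blast
    then show ?thesis using dle[OF v] by (smt (verit) norm_ge_zero power_mono)
  qed
  have "\<exists>v\<in>C n. (norm v)\<^sup>2 < d n + 1 / real (Suc n)" for n
  proof -
    have "(INF v\<in>C n. (norm v)\<^sup>2) < d n + 1 / real (Suc n)" by (simp add: d_def)
    then show ?thesis using cINF_less_iff[OF ne bb] by blast
  qed
  then obtain v where v: "\<And>n. v n \<in> C n" "\<And>n. (norm (v n))\<^sup>2 < d n + 1 / real (Suc n)" by metis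
  have "incseq d" using dmono by (simp add: incseq_def)
  moreover have "\<forall>i. d i \<le> M\<^sup>2" using dM by blast
  ultimately obtain l where l: "d \<longlonglongrightarrow> l" "\<And>i. d i \<le> l" using incseq_convergent by metis
  \<comment> \<open>For \<open>m \<le> n\<close> both points lie in \<open>C m\<close>, hence so
    does their midpoint, whose squared norm is therefore at least \<open>d m\<close>.\<close>
  have par: "(norm (v n - v m))\<^sup>2 \<le> 4 * (l - d m) + 4 * (1 / real (Suc m))" if "m \<le> n" for m n
  proof -
    have "(1/2) *\<^sub>R v n + (1/2) *\<^sub>R v m \<in> C m"
      using v(1) dec[OF that] by (intro convexD[OF cv]) auto
    from dle[OF this] have "4 * d m \<le> 4 * (norm ((1/2) *\<^sub>R v n + (1/2) *\<^sub>R v m))\<^sup>2" by simp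
    also have "\<dots> = (norm (v n + v m))\<^sup>2"
      by (simp add: scaleR_add_right[symmetric] power_mult_distrib power2_eq_square)
    finally have "4 * d m \<le> (norm (v n + v m))\<^sup>2" .
    moreover have "(norm (v n - v m))\<^sup>2 + (norm (v n + v m))\<^sup>2 = 2 * (norm (v n))\<^sup>2 + 2 * (norm (v m))\<^sup>2"
      by (simp add: power2_norm_eq_inner inner_diff_left inner_diff_right inner_add_left inner_add_right
          inner_commute)
    moreover have "1 / real (Suc n) \<le> 1 / real (Suc m)" using that by (simp add: frac_le)
    ultimately show ?thesis using v(2)[of n] v(2)[of m] l(2)[of n] dmono[OF that] by argo
  qed
  have tend: "(\<lambda>m. 4 * (l - d m) + 4 * (1 / real (Suc m))) \<longlonglongrightarrow> 4 * (l - l) + 4 * 0"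
    by (intro tendsto_intros l LIMSEQ_Suc lim_1_over_n)
  have "Cauchy v"
  proof (rule metric_CauchyI)
    fix e :: real assume e: "e > 0"
    then have "eventually (\<lambda>m. 4 * (l - d m) + 4 * (1 / real (Suc m)) < (e/2)\<^sup>2) sequentially"
      using order_tendstoD(2)[OF tend, of "(e/2)\<^sup>2"] by simp
    then obtain N where N: "4 * (l - d N) + 4 * (1 / real (Suc N)) < (e/2)\<^sup>2"
      by (auto simp: eventually_sequentially)
    have "dist (v n) (v N) < e / 2" if "N \<le> n" for n
      unfolding dist_norm using par[OF that] N e by (intro power_less_imp_less_base[of _ 2 "e/2"]) auto
    then show "\<exists>N. \<forall>m\<ge>N. \<forall>n\<ge>N. dist (v m) (v n) < e"
      by (meson dist_triangle_half_l dist_commute)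
  qed
  then obtain w where w: "v \<longlonglongrightarrow> w" using Cauchy_convergent convergent_def by blast
  have "w \<in> C n" for n
  proof (rule closed_sequentially[OF cl])
    show "v (k + n) \<in> C n" for k using v(1) dec[of n "k + n"] by auto
    show "(\<lambda>k. v (k + n)) \<longlonglongrightarrow> w" using w by (rule LIMSEQ_ignore_initial_segment)
  qed
  then show ?thesis by blast
qed

text \<open>A late tail lies in the slab where the inner product with \<open>y\<close> is within
  \<open>e\<close> of \<open>c\<close>. The slab is closed and convex, so it contains
  \<open>q\<close> too.\<close>

lemma closure_convex_hull_inner_tendsto:
  fixes X :: "real \<Rightarrow> 'a::real_inner"
  assumes q: "\<And>T. q \<in> closure (convex hull (X ` {t. t \<ge> T \<and> P t}))"
    and lim: "((\<lambda>t. inner (X t) y) \<longlongrightarrow> c) at_top"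
  shows "inner q y = c"
proof -
  have "\<bar>inner q y - c\<bar> \<le> e" if e: "e > 0" for e
  proof -
    obtain T where T: "\<And>t. t \<ge> T \<Longrightarrow> \<bar>inner (X t) y - c\<bar> < e"
      using tendstoD[OF lim e] by (auto simp: eventually_at_top_linorder dist_real_def)
    let ?H = "{z. inner y z \<le> c + e} \<inter> {z. inner y z \<ge> c - e}"
    have "X ` {t. t \<ge> T \<and> P t} \<subseteq> ?H" using T by (fastforce simp: inner_commute abs_less_iff)
    moreover have "convex ?H" "closed ?H"
      by (auto intro!: convex_Int convex_halfspace_le convex_halfspace_ge closed_Int
          closed_halfspace_le closed_halfspace_ge)
    ultimately have "closure (convex hull (X ` {t. t \<ge> T \<and> P t})) \<subseteq> ?H"
      by (intro closure_minimal hull_minimal)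
    then show ?thesis using q[of T] by (auto simp: inner_commute abs_le_iff)
  qed
  then show ?thesis by (metis abs_0_eq abs_ge_zero dense_ge eq_iff_diff_eq_0 order_antisym)
qed

text \<open>Opial's lemma. Weak sequential compactness is avoided: nested closed convex hulls of the
  tails of the trajectory supply the candidate limits, and two candidates coincide because
  differences of points of \<open>S\<close> have convergent inner products with the trajectory.\<close>

lemma opial:
  fixes X :: "real \<Rightarrow> 'a::{real_inner, complete_space}"
  assumes ne: "S \<noteq> {}"
    and lim: "\<And>z. z \<in> S \<Longrightarrow> \<exists>l. ((\<lambda>t. (norm (X t - z))\<^sup>2) \<longlongrightarrow> l) at_top"
    and tails: "\<And>q. (\<And>T. q \<in> closure (convex hull (X ` {T..}))) \<Longrightarrow> q \<in> S"
  shows "\<exists>z\<in>S. converges_weakly X z"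
proof -
  obtain z0 where z0: "z0 \<in> S" using ne by blast
  obtain l0 where l0: "((\<lambda>t. (norm (X t - z0))\<^sup>2) \<longlongrightarrow> l0) at_top" using lim[OF z0] by blast
  obtain T0 where T0: "\<And>t. t \<ge> T0 \<Longrightarrow> (norm (X t - z0))\<^sup>2 < \<bar>l0\<bar> + 1"
  proof -
    have "l0 < \<bar>l0\<bar> + 1" by linarith
    from order_tendstoD(2)[OF l0 this] show ?thesis
      using that by (auto simp: eventually_at_top_linorder)
  qed
  have bdd: "bounded (X ` {T0..})"
  proof (rule boundedI)
    fix v assume "v \<in> X ` {T0..}"
    then have "(norm (v - z0))\<^sup>2 < \<bar>l0\<bar> + 1" using T0 by auto
    then have "norm (v - z0) \<le> sqrt (\<bar>l0\<bar> + 1)" by (simp add: real_le_rsqrt)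
    then show "norm v \<le> norm z0 + sqrt (\<bar>l0\<bar> + 1)" by (smt (verit) norm_triangle_sub)
  qed
  \<comment> \<open>\<open>P\<close> selects arbitrarily late times. The constantly true
    \<open>P\<close> yields the candidate limit \<open>p\<close>; later \<open>P\<close> selects the
    times at which convergence would fail.\<close>
  have cluster: "\<exists>q. \<forall>T. q \<in> closure (convex hull (X ` {t. t \<ge> T \<and> P t}))"
    if P: "\<And>T. \<exists>t\<ge>T. P t" for P
  proof -
    define A where "A T = closure (convex hull (X ` {t. t \<ge> T \<and> P t}))" for T
    have mono: "A T' \<subseteq> A T" if "T \<le> T'" for T T'
      unfolding A_def using that by (intro closure_mono hull_mono image_mono) auto
    have "\<Inter> (range (\<lambda>n. A (T0 + real n))) \<noteq> {}"
    proof (rule closed_convex_nested_Inter_nonempty)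
      show "A (T0 + real n) \<noteq> {}" for n unfolding A_def using P[of "T0 + real n"] by auto
      show "bounded (A (T0 + real 0))" unfolding A_def
        by (intro bounded_closure bounded_convex_hull bounded_subset[OF bdd]) auto
      show "A (T0 + real n) \<subseteq> A (T0 + real m)" if "m \<le> n" for m n using that by (intro mono) auto
    qed (auto simp: A_def intro: convex_closure)
    then obtain q where q: "\<And>n::nat. q \<in> A (T0 + real n)" by blast
    have "q \<in> A T" for T
    proof -
      obtain n :: nat where "real n \<ge> T - T0" using real_arch_simple by blast
      then show ?thesis using q mono[of T "T0 + real n"] by fastforce
    qed
    then show ?thesis unfolding A_def by blast
  qed
  have inS: "q \<in> S" if "\<And>T. q \<in> closure (convex hull (X ` {t. t \<ge> T \<and> P t}))" for q P
  proof (rule tails)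
    fix T
    have "closure (convex hull (X ` {t. t \<ge> T \<and> P t})) \<subseteq> closure (convex hull (X ` {T..}))"
      by (intro closure_mono hull_mono image_mono) auto
    then show "q \<in> closure (convex hull (X ` {T..}))" using that by blast
  qed
  obtain p where p: "\<And>T. p \<in> closure (convex hull (X ` {t. t \<ge> T \<and> True}))"
    using cluster[of "\<lambda>_. True"] by auto
  have pS: "p \<in> S" using inS[OF p] .
  have uniq: "q = p" if q: "\<And>T. q \<in> closure (convex hull (X ` {t. t \<ge> T \<and> P t}))" for q P
  proof -
    have qS: "q \<in> S" using inS[OF q] .
    obtain lp lq where l: "((\<lambda>t. (norm (X t - p))\<^sup>2) \<longlongrightarrow> lp) at_top"
      "((\<lambda>t. (norm (X t - q))\<^sup>2) \<longlongrightarrow> lq) at_top" using lim pS qS by meson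
    \<comment> \<open>Expanding both squares cancels the norm of \<open>X t\<close>, so the inner
      product with \<open>q - p\<close> converges because both distances do. Its limit is then the
      value at \<open>q\<close> as well as at \<open>p\<close>.\<close>
    have eq: "inner (X t) (q - p) = ((norm (X t - p))\<^sup>2 - (norm (X t - q))\<^sup>2 + (norm q)\<^sup>2 - (norm p)\<^sup>2) / 2"
      for t by (simp add: power2_norm_eq_inner inner_diff_left inner_diff_right inner_commute)
    have c: "((\<lambda>t. inner (X t) (q - p)) \<longlongrightarrow> (lp - lq + (norm q)\<^sup>2 - (norm p)\<^sup>2) / 2) at_top"
      unfolding eq by (intro tendsto_intros l) simp
    have "inner q (q - p) = inner p (q - p)"
      using closure_convex_hull_inner_tendsto[OF q c] closure_convex_hull_inner_tendsto[OF p c] by simp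
    then have "inner (q - p) (q - p) = 0" by (simp add: inner_diff_left)
    then show ?thesis by simp
  qed
  \<comment> \<open>Otherwise the offending times have a cluster point of their own. It lies in the
    half-space of value at least \<open>inner p y + e\<close>, yet by \<open>uniq\<close> it is
    \<open>p\<close>. The matching lower bound comes from replacing \<open>y\<close> by
    \<open>- y\<close>.\<close>
  have upper: "eventually (\<lambda>t. inner (X t) y < inner p y + e) at_top" if e: "e > 0" for y e
  proof (rule ccontr)
    assume "\<not> ?thesis"
    then have "\<exists>t\<ge>T. inner (X t) y \<ge> inner p y + e" for T
      unfolding eventually_at_top_linorder by (meson linorder_not_le)
    from cluster[OF this] obtain q where q: "\<And>T. q \<in>
        closure (convex hull (X ` {t. t \<ge> T \<and> inner (X t) y \<ge> inner p y + e}))" by blast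
    have "closure (convex hull (X ` {t. t \<ge> 0 \<and> inner (X t) y \<ge> inner p y + e}))
        \<subseteq> {z. inner y z \<ge> inner p y + e}"
      by (intro closure_minimal hull_minimal convex_halfspace_ge closed_halfspace_ge)
        (auto simp: inner_commute)
    with q[of 0] have "inner y q \<ge> inner p y + e" by blast
    then show False using uniq[OF q] e by (simp add: inner_commute)
  qed
  have "converges_weakly X p" unfolding converges_weakly_def
  proof (intro allI tendstoI)
    fix y :: 'a and e :: real assume e: "e > 0"
    show "eventually (\<lambda>t. dist (inner (X t) y) (inner p y) < e) at_top"
      using upper[OF e, of y] upper[OF e, of "- y"]
      by eventually_elim (auto simp: dist_real_def abs_less_iff)
  qed
  then show ?thesis using pS by blast
qed

section \<open>The Lyapunov function\<close>

text \<open>Along the segment from \<open>y\<close> to \<open>z\<close> the difference quotients at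
  \<open>y\<close> are at most \<open>f z - f y\<close>, and they tend to the directional
  derivative.\<close>

lemma convex_gderiv_le:
  fixes f :: "'a::real_inner \<Rightarrow> real"
  assumes cv: "convex_on UNIV f" and g: "GDERIV f y :> g"
  shows "inner g (z - y) \<le> f z - f y"
proof -
  define k where "k s = f (y + s *\<^sub>R (z - y))" for s
  have "((\<lambda>s. y + s *\<^sub>R (z - y)) has_derivative (\<lambda>s. s *\<^sub>R (z - y))) (at 0)"
    by (auto intro!: derivative_eq_intros)
  moreover have "(f has_derivative (\<lambda>h. inner h g)) (at (y + 0 *\<^sub>R (z - y)))"
    using g by (simp add: gderiv_def)
  ultimately have "(k has_derivative (\<lambda>s. inner (s *\<^sub>R (z - y)) g)) (at 0)"
    unfolding k_def by (rule has_derivative_compose)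
  moreover have "(\<lambda>s. inner (s *\<^sub>R (z - y)) g) = (*) (inner g (z - y))"
    by (auto simp: inner_commute)
  ultimately have "(k has_real_derivative inner g (z - y)) (at 0)"
    by (simp add: has_field_derivative_def)
  then have "(k has_real_derivative inner g (z - y)) (at_right 0)"
    by (rule has_field_derivative_at_within)
  then have lim: "((\<lambda>s. (k s - k 0) / s) \<longlongrightarrow> inner g (z - y)) (at_right 0)"
    unfolding has_field_derivative_iff by simp
  have "eventually (\<lambda>s. (k s - k 0) / s \<le> f z - f y) (at_right 0)"
  proof (rule eventually_at_rightI[of 0 1])
    fix s :: real assume s: "s \<in> {0<..<1}"
    have "y + s *\<^sub>R (z - y) = (1 - s) *\<^sub>R y + s *\<^sub>R z" by (simp add: algebra_simps)
    then have "k s \<le> (1 - s) * f y + s * f z"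
      unfolding k_def using convex_onD[OF cv, of s y z] s by auto
    then show "(k s - k 0) / s \<le> f z - f y" using s by (simp add: k_def field_simps)
  qed simp
  from tendsto_upperbound[OF lim this] show ?thesis by simp
qed

lemma gderiv_has_real_derivative_compose:
  assumes "GDERIV f (x t) :> g" "(x has_vector_derivative v) (at t within S)"
  shows "((\<lambda>t. f (x t)) has_real_derivative inner v g) (at t within S)"
proof -
  have "((\<lambda>t. f (x t)) has_derivative (\<lambda>s. inner (s *\<^sub>R v) g)) (at t within S)"
    by (rule has_derivative_compose[OF assms(2)[unfolded has_vector_derivative_def]
          assms(1)[unfolded gderiv_def]])
  moreover have "(\<lambda>s. inner (s *\<^sub>R v) g) = (*) (inner v g)" by auto
  ultimately show ?thesis by (simp add: has_field_derivative_def)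
qed

lemma inner_has_real_derivative:
  assumes "(f has_vector_derivative f') (at t within S)" "(g has_vector_derivative g') (at t within S)"
  shows "((\<lambda>t. inner (f t) (g t)) has_real_derivative inner (f t) g' + inner f' (g t)) (at t within S)"
proof -
  have "((\<lambda>t. inner (f t) (g t)) has_derivative
      (\<lambda>h. inner (f t) (h *\<^sub>R g') + inner (h *\<^sub>R f') (g t))) (at t within S)"
    using assms unfolding has_vector_derivative_def by (intro has_derivative_inner)
  moreover have "(\<lambda>h. inner (f t) (h *\<^sub>R g') + inner (h *\<^sub>R f') (g t)) =
      (\<lambda>h. (inner (f t) g' + inner f' (g t)) * h)" by (auto simp: algebra_simps)
  ultimately show ?thesis by (simp add: has_field_derivative_def)
qed

text \<open>\<open>p\<close> stands for the positive part of the derivative of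
  \<open>t powr \<theta> * \<gamma> t\<close>, entering through its integrability and the increment
  bound. Starting at \<open>T \<ge> 1\<close> makes powers of \<open>t\<close> positive and monotone
  in the exponent.\<close>

locale damped_trajectory =
  fixes \<Phi> U :: "'a::{real_inner, complete_space} \<Rightarrow> real"
    and grad\<Phi> gradU :: "'a \<Rightarrow> 'a"
    and \<gamma> \<epsilon> p :: "real \<Rightarrow> real"
    and x x' x'' :: "real \<Rightarrow> 'a"
    and T \<theta> \<alpha> :: real
  assumes T: "T \<ge> 1"
    and convex_\<Phi>: "convex_on UNIV \<Phi>" and convex_U: "convex_on UNIV U"
    and grad_\<Phi>: "C1_gradient \<Phi> grad\<Phi>" and grad_U: "C1_gradient U gradU"
    and bdd_\<Phi>: "bdd_below (range \<Phi>)" and bdd_U: "bdd_below (range U)"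
    and \<gamma>_cont: "continuous_on {T..} \<gamma>"
    and \<epsilon>_cont: "continuous_on {T..} \<epsilon>"
    and \<epsilon>_pos: "\<And>t. T \<le> t \<Longrightarrow> 0 < \<epsilon> t"
    and \<epsilon>_antimono: "\<And>s t. T \<le> s \<Longrightarrow> s \<le> t \<Longrightarrow> \<epsilon> t \<le> \<epsilon> s"
    and \<theta>: "0 \<le> \<theta>" "\<theta> \<le> 1"
    and \<alpha>: "0 < \<alpha>" "\<theta> = 1 \<Longrightarrow> 3 < \<alpha>"
    and \<gamma>_lower: "\<And>t. T \<le> t \<Longrightarrow> \<alpha> / t powr \<theta> \<le> \<gamma> t"
    and p: "p absolutely_integrable_on {T..}" "\<And>t. 0 \<le> p t"
    and \<gamma>_inc: "increment_le T (\<lambda>t. t powr \<theta> * \<gamma> t) p"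
    and x_deriv: "\<And>t. T \<le> t \<Longrightarrow> (x has_vector_derivative x' t) (at t within {T..})"
    and x'_deriv: "\<And>t. T \<le> t \<Longrightarrow> (x' has_vector_derivative x'' t) (at t within {T..})"
    and x''_cont: "continuous_on {T..} x''"
    and ode: "\<And>t. T \<le> t \<Longrightarrow> x'' t + \<gamma> t *\<^sub>R x' t + grad\<Phi> (x t) + \<epsilon> t *\<^sub>R gradU (x t) = 0"
begin

abbreviation W where "W \<equiv> energy \<Phi> U \<epsilon> x x'"

lemma x_cont: "continuous_on {T..} x" and x'_cont: "continuous_on {T..} x'"
  using x_deriv x'_deriv by (auto intro!: continuous_on_vector_derivative)

lemma grad_cont: "continuous_on {T..} (\<lambda>t. grad\<Phi> (x t))" "continuous_on {T..} (\<lambda>t. gradU (x t))"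
  using grad_\<Phi> grad_U x_cont unfolding C1_gradient_def
  by (auto intro: continuous_on_compose2)

lemma \<Phi>_deriv: "T \<le> t \<Longrightarrow> ((\<lambda>t. \<Phi> (x t)) has_real_derivative inner (x' t) (grad\<Phi> (x t))) (at t within {T..})"
  and U_deriv: "T \<le> t \<Longrightarrow> ((\<lambda>t. U (x t)) has_real_derivative inner (x' t) (gradU (x t))) (at t within {T..})"
  using grad_\<Phi> grad_U x_deriv unfolding C1_gradient_def
  by (auto intro: gderiv_has_real_derivative_compose)

lemma \<Phi>_cont: "continuous_on {T..} (\<lambda>t. \<Phi> (x t))" and U_cont: "continuous_on {T..} (\<lambda>t. U (x t))"
  using \<Phi>_deriv U_deriv by (auto intro!: DERIV_continuous_on)

lemma W_cont: "continuous_on {T..} W"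
  unfolding energy_def[abs_def] by (intro continuous_intros x'_cont \<Phi>_cont U_cont \<epsilon>_cont)

lemma Inf_\<Phi>_le: "(INF z. \<Phi> z) \<le> \<Phi> y" and Inf_U_le: "(INF z. U z) \<le> U y"
  using bdd_\<Phi> bdd_U by (auto intro: cINF_lower)

lemma W_ge: "T \<le> t \<Longrightarrow> 1 / 2 * (norm (x' t))\<^sup>2 \<le> W t" "T \<le> t \<Longrightarrow> \<Phi> (x t) - (INF z. \<Phi> z) \<le> W t"
  "T \<le> t \<Longrightarrow> \<epsilon> t * (U (x t) - (INF z. U z)) \<le> W t"
proof -
  assume t: "T \<le> t"
  have "0 \<le> \<epsilon> t * (U (x t) - (INF z. U z))" using \<epsilon>_pos[OF t] Inf_U_le[of "x t"] by simp
  then show "1 / 2 * (norm (x' t))\<^sup>2 \<le> W t" "\<Phi> (x t) - (INF z. \<Phi> z) \<le> W t"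
    "\<epsilon> t * (U (x t) - (INF z. U z)) \<le> W t"
    using Inf_\<Phi>_le[of "x t"] zero_le_power2[of "norm (x' t)"] unfolding energy_def by linarith+
qed

lemma W_nonneg: "T \<le> t \<Longrightarrow> 0 \<le> W t"
  using W_ge(1)[of t] zero_le_power2[of "norm (x' t)"] by linarith

lemma \<gamma>_pos: "T \<le> t \<Longrightarrow> 0 < \<gamma> t"
  using \<gamma>_lower[of t] \<alpha>(1) T by (smt (verit) divide_pos_pos powr_gt_zero)

text \<open>The kinetic and \<open>\<Phi>\<close> parts are differentiated.
  \<open>\<epsilon>\<close>, being nonincreasing, has increments bounded by the integral of 0, and
  its factor \<open>w * (U - inf U)\<close> is nonnegative, so \<open>increment_le_mult\<close>
  applies. The equation of motion cancels all gradient terms and leaves the damping.\<close>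

lemma weighted_energy_increment:
  assumes w: "\<And>t. T \<le> t \<Longrightarrow> (w has_real_derivative w' t) (at t within {T..})"
    and w0: "\<And>t. T \<le> t \<Longrightarrow> 0 \<le> w t" and cw': "continuous_on {T..} w'"
  shows "increment_le T (\<lambda>t. w t * W t) (\<lambda>t. w' t * W t - w t * \<gamma> t * (norm (x' t))\<^sup>2)"
proof -
  have cw: "continuous_on {T..} w" using w by (auto intro!: DERIV_continuous_on)
  note cont = cw cw' x'_cont x''_cont grad_cont \<Phi>_cont U_cont
  let ?K = "\<lambda>t. inner (x' t) (x' t) / 2 + \<Phi> (x t) - (INF z. \<Phi> z)"
  let ?Y = "\<lambda>t. U (x t) - (INF z. U z)"
  have 1: "increment_le T (\<lambda>t. w t * ?K t)
      (\<lambda>t. w' t * ?K t + w t * (inner (x' t) (x'' t) + inner (x' t) (grad\<Phi> (x t))))"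
  proof (rule increment_le_derivative)
    fix t assume t: "T \<le> t"
    have "(?K has_real_derivative (inner (x' t) (x'' t) + inner (x'' t) (x' t)) / 2
        + inner (x' t) (grad\<Phi> (x t)) - 0) (at t within {T..})"
      by (intro DERIV_diff DERIV_add DERIV_cdivide inner_has_real_derivative x'_deriv \<Phi>_deriv
          DERIV_const t)
    from DERIV_mult[OF w[OF t] this]
    show "((\<lambda>t. w t * ?K t) has_real_derivative
        w' t * ?K t + w t * (inner (x' t) (x'' t) + inner (x' t) (grad\<Phi> (x t)))) (at t within {T..})"
      by (simp add: inner_commute mult.commute)
  qed (intro continuous_intros cont; simp)
  have dY: "((\<lambda>t. w t * ?Y t) has_real_derivative w' t * ?Y t + w t * inner (x' t) (gradU (x t)))
      (at t within {T..})" if t: "T \<le> t" for t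
    using DERIV_mult[OF w[OF t] DERIV_diff[OF U_deriv[OF t] DERIV_const[of "INF z. U z"]]]
    by (simp add: mult.commute)
  have "increment_le T \<epsilon> (\<lambda>_. 0)"
    by (rule increment_leI) (use \<epsilon>_antimono in \<open>auto simp: absolutely_integrable_on_def\<close>)
  then have 2: "increment_le T (\<lambda>t. \<epsilon> t * (w t * ?Y t))
      (\<lambda>t. 0 * (w t * ?Y t) + \<epsilon> t * (w' t * ?Y t + w t * inner (x' t) (gradU (x t))))"
    using w0 Inf_U_le dY
    by (intro increment_le_mult \<epsilon>_cont continuous_intros cont mult_nonneg_nonneg) auto
  show ?thesis
  proof (rule increment_le_cong[OF increment_le_add[OF 1 2]])
    fix t assume t: "T \<le> t"
    show "w t * ?K t + \<epsilon> t * (w t * ?Y t) = w t * W t"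
      by (simp add: energy_def power2_norm_eq_inner algebra_simps)
    have "x'' t = (x'' t + \<gamma> t *\<^sub>R x' t + grad\<Phi> (x t) + \<epsilon> t *\<^sub>R gradU (x t))
        - \<epsilon> t *\<^sub>R gradU (x t) - grad\<Phi> (x t) - \<gamma> t *\<^sub>R x' t" by simp
    then have "x'' t = - (\<gamma> t *\<^sub>R x' t) - grad\<Phi> (x t) - \<epsilon> t *\<^sub>R gradU (x t)"
      unfolding ode[OF t] by simp
    then have "inner (x' t) (x'' t) = - \<gamma> t * inner (x' t) (x' t) - inner (x' t) (grad\<Phi> (x t))
        - \<epsilon> t * inner (x' t) (gradU (x t))" by (simp add: inner_diff_right)
    then show "w' t * ?K t + w t * (inner (x' t) (x'' t) + inner (x' t) (grad\<Phi> (x t))) +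
        (0 * (w t * ?Y t) + \<epsilon> t * (w' t * ?Y t + w t * inner (x' t) (gradU (x t)))) =
        w' t * W t - w t * \<gamma> t * (norm (x' t))\<^sup>2"
      by (simp only:) (simp add: energy_def power2_norm_eq_inner ring_distribs mult_ac)
  qed
qed

text \<open>The constant weight 1 leaves only the damping term, which is nonpositive.\<close>

lemma W_antimono:
  assumes "T \<le> s" "s \<le> t"
  shows "W t \<le> W s"
proof -
  have inc: "increment_le T (\<lambda>t. 1 * W t) (\<lambda>t. 0 * W t - 1 * \<gamma> t * (norm (x' t))\<^sup>2)"
    by (rule weighted_energy_increment) auto
  have "integral {s..t} (\<lambda>t. 0 * W t - 1 * \<gamma> t * (norm (x' t))\<^sup>2) \<le> integral {s..t} (\<lambda>_. 0)"
    using assms \<gamma>_pos by (intro integral_le increment_leD(2)[OF inc assms]) (auto simp: less_imp_le)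
  then show ?thesis using increment_leD(3)[OF inc assms] by simp
qed

text \<open>An upper rate for the coefficient \<open>t powr \<theta> * \<gamma> t - \<theta> * t
  powr (\<theta> - 1)\<close>: \<open>p\<close> bounds the growth of its first part, and the second
  summand is the derivative of \<open>- \<theta> * t powr (\<theta> - 1)\<close>.\<close>

definition \<omega> where "\<omega> t = p t + \<theta> * (1 - \<theta>) * t powr (\<theta> - 2)"

lemma \<omega>_nonneg: "0 \<le> \<omega> t" unfolding \<omega>_def using p(2) \<theta> by simp

lemma \<omega>_integrable: "\<omega> absolutely_integrable_on {T..}"
proof -
  have "(\<lambda>t. \<theta> * (1 - \<theta>) * t powr (\<theta> - 2)) absolutely_integrable_on {T..}"
  \<comment> \<open>For \<open>\<theta> < 1\<close> the exponent \<open>\<theta> - 2\<close> is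
    below -1; for \<open>\<theta> = 1\<close> the coefficient vanishes.\<close>
  proof (cases "\<theta> = 1")
    case False
    have "(\<lambda>t. t powr (\<theta> - 2)) integrable_on {T..}"
      using has_integral_powr_to_inf[of "\<theta> - 2" T] False \<theta> T by auto
    then have "(\<lambda>t. t powr (\<theta> - 2)) absolutely_integrable_on {T..}"
      by (intro nonnegative_absolutely_integrable_1) auto
    then show ?thesis by (rule set_integrable_mult_right)
  qed (simp add: absolutely_integrable_on_def)
  then show ?thesis unfolding \<omega>_def[abs_def] using p(1) by (intro set_integral_add)
qed

lemma powr_deriv:
  assumes "T \<le> t"
  shows "((\<lambda>t. t powr a) has_real_derivative a * t powr (a - 1)) (at t within S)"
proof -
  have "t > 0" using assms T by simp
  from has_real_derivative_powr[OF this, of a] show ?thesis by (rule has_field_derivative_at_within)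
qed

lemma powr_cont: "continuous_on {T..} (\<lambda>t. t powr a)"
  using T by (intro continuous_intros) auto

text \<open>With \<open>h\<close> half the squared distance to \<open>z\<close>, differentiating
  \<open>t powr \<theta> * h'\<close> creates \<open>\<theta> * t powr (\<theta> - 1) * h'\<close>,
  which the correction \<open>- \<theta> * t powr (\<theta> - 1) * h\<close> cancels. The part
  \<open>t powr \<theta> * \<gamma> t * h\<close> is treated by \<open>increment_le_mult\<close>,
  its weight having only an increment bound.\<close>

lemma anchor_increment:
  "increment_le T
     (\<lambda>t. t powr \<theta> * inner (x' t) (x t - z) +
          (t powr \<theta> * \<gamma> t - \<theta> * t powr (\<theta> - 1)) * ((norm (x t - z))\<^sup>2 / 2))
     (\<lambda>t. \<omega> t * ((norm (x t - z))\<^sup>2 / 2) +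
          t powr \<theta> * ((norm (x' t))\<^sup>2 + inner (x'' t + \<gamma> t *\<^sub>R x' t) (x t - z)))"
proof -
  let ?h = "\<lambda>t. inner (x t - z) (x t - z) / 2"
  note cont = x_cont x'_cont x''_cont powr_cont \<gamma>_cont
  have dxz: "((\<lambda>t. x t - z) has_vector_derivative x' t) (at t within {T..})" if "T \<le> t" for t
    using has_vector_derivative_diff[OF x_deriv[OF that] has_vector_derivative_const] by simp
  have dh: "(?h has_real_derivative inner (x' t) (x t - z)) (at t within {T..})" if t: "T \<le> t" for t
    using DERIV_cdivide[OF inner_has_real_derivative[OF dxz[OF t] dxz[OF t]], of 2]
    by (simp add: inner_commute)
  have ch: "continuous_on {T..} ?h" by (intro continuous_intros cont) simp
  have 1: "increment_le T (\<lambda>t. t powr \<theta> * inner (x' t) (x t - z) - \<theta> * t powr (\<theta> - 1) * ?h t)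
     (\<lambda>t. t powr \<theta> * (inner (x' t) (x' t) + inner (x'' t) (x t - z)) + \<theta> * (1 - \<theta>) * t powr (\<theta> - 2) * ?h t)"
  proof (rule increment_le_derivative)
    fix t assume t: "T \<le> t"
    have "((\<lambda>t. t powr \<theta> * inner (x' t) (x t - z) - \<theta> * t powr (\<theta> - 1) * ?h t) has_real_derivative
        (\<theta> * t powr (\<theta> - 1)) * inner (x' t) (x t - z) + (inner (x' t) (x' t) + inner (x'' t) (x t - z)) * t powr \<theta>
        - ((\<theta> * ((\<theta> - 1) * t powr (\<theta> - 1 - 1))) * ?h t + inner (x' t) (x t - z) * (\<theta> * t powr (\<theta> - 1))))
        (at t within {T..})"
      by (intro DERIV_diff DERIV_mult DERIV_cmult powr_deriv inner_has_real_derivative dxz x'_deriv dh t)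
    then show "((\<lambda>t. t powr \<theta> * inner (x' t) (x t - z) - \<theta> * t powr (\<theta> - 1) * ?h t) has_real_derivative
        t powr \<theta> * (inner (x' t) (x' t) + inner (x'' t) (x t - z)) + \<theta> * (1 - \<theta>) * t powr (\<theta> - 2) * ?h t)
        (at t within {T..})"
      by (rule DERIV_cong) (simp add: ring_distribs mult_ac)
  qed (intro continuous_intros cont ch; simp)
  have 2: "increment_le T (\<lambda>t. (t powr \<theta> * \<gamma> t) * ?h t)
     (\<lambda>t. p t * ?h t + (t powr \<theta> * \<gamma> t) * inner (x' t) (x t - z))"
    by (intro increment_le_mult \<gamma>_inc p(2) continuous_intros cont dh) auto
  show ?thesis
    by (rule increment_le_cong[OF increment_le_add[OF 1 2]])
      (simp_all add: \<omega>_def power2_norm_eq_inner inner_add_left ring_distribs mult_ac)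
qed

text \<open>The equation replaces \<open>x'' + \<gamma> x'\<close> by minus the gradients, and
  convexity bounds their inner products by value differences. As \<open>\<Phi> z\<close> is the
  infimum, these differences are the potential part of \<open>- W\<close> plus the remainder in
  \<open>U z\<close>; restoring the kinetic half turns the coefficient 1 into 3/2.\<close>

lemma anchor_le:
  assumes z: "z \<in> argmin_set \<Phi>" and t: "T \<le> t"
  shows "(norm (x' t))\<^sup>2 + inner (x'' t + \<gamma> t *\<^sub>R x' t) (x t - z) \<le>
    3 / 2 * (norm (x' t))\<^sup>2 - W t + \<epsilon> t * (U z - (INF z. U z))"
proof -
  have gd: "GDERIV \<Phi> (x t) :> grad\<Phi> (x t)" "GDERIV U (x t) :> gradU (x t)"
    using grad_\<Phi> grad_U by (auto simp: C1_gradient_def)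
  have "x'' t + \<gamma> t *\<^sub>R x' t = (x'' t + \<gamma> t *\<^sub>R x' t + grad\<Phi> (x t) + \<epsilon> t *\<^sub>R gradU (x t))
      - \<epsilon> t *\<^sub>R gradU (x t) - grad\<Phi> (x t)" by simp
  then have "x'' t + \<gamma> t *\<^sub>R x' t = - grad\<Phi> (x t) - \<epsilon> t *\<^sub>R gradU (x t)"
    unfolding ode[OF t] by simp
  then have "inner (x'' t + \<gamma> t *\<^sub>R x' t) (x t - z) =
      inner (grad\<Phi> (x t)) (z - x t) + \<epsilon> t * inner (gradU (x t)) (z - x t)"
    by (simp only:) (simp add: inner_diff_left inner_diff_right right_diff_distrib)
  also have "\<dots> \<le> (\<Phi> z - \<Phi> (x t)) + \<epsilon> t * (U z - U (x t))"
    using \<epsilon>_pos[OF t] by (intro add_mono mult_left_mono convex_gderiv_le convex_\<Phi> convex_U gd) auto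
  also have "\<Phi> z = (INF z. \<Phi> z)" using z by (simp add: argmin_set_def)
  finally show ?thesis by (simp add: energy_def algebra_simps)
qed

end

section \<open>Choice of the Lyapunov parameters and the resulting energy decay\<close>

lemma powr_eventually_le:
  fixes a u :: real
  assumes "a < 0" "u > 0"
  shows "\<exists>S. \<forall>t\<ge>S. t powr a \<le> u"
proof -
  have "((\<lambda>t::real. t powr a) \<longlongrightarrow> 0) at_top"
    by (rule tendsto_neg_powr[OF assms(1) filterlim_ident])
  from order_tendstoD(2)[OF this assms(2)] show ?thesis
    by (auto simp: eventually_at_top_linorder intro: less_imp_le)
qed

text \<open>The weight \<open>\<mu>\<close> of the energy must make the Lyapunov function a positive definite quadratic form
  and leave the damping dominant; for \<open>\<theta> = 1\<close> an admissible \<open>\<mu>\<close> exists exactly when \<open>\<alpha> > 3\<close>.\<close>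

lemma lyapunov_parameters:
  fixes \<theta> \<alpha> :: real
  assumes \<theta>: "0 \<le> \<theta>" "\<theta> \<le> 1" and \<alpha>: "0 < \<alpha>" "\<theta> = 1 \<Longrightarrow> 3 < \<alpha>"
  shows "\<exists>\<mu> \<eta> S. 0 < \<mu> \<and> \<mu> * (1 + \<theta>) < 1 \<and> 0 < \<eta> \<and> \<eta> < 1 \<and> (\<forall>t\<ge>S. t > 0 \<longrightarrow>
    3 / 2 * t powr (\<theta> - 1) \<le> \<mu> * \<alpha> \<and> \<eta> \<le> \<alpha> - \<theta> * t powr (\<theta> - 1) \<and>
    t powr (\<theta> - 1) \<le> \<mu> * (1 - \<eta>) * (\<alpha> - \<theta> * t powr (\<theta> - 1) - \<eta>))"
proof (cases "\<theta> = 1")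
  case True
  then have a3: "\<alpha> > 3" using \<alpha> by simp
  \<comment> \<open>The first lower bound for \<open>\<mu>\<close> serves the damping and the second
    the quadratic form; the upper bound 1/2 is \<open>\<mu> * (1 + \<theta>) < 1\<close> at
    \<open>\<theta> = 1\<close>. Both lower bounds are below 1/2 because
    \<open>\<alpha> > 3\<close>.\<close>
  then have "max (3 / (2 * \<alpha>)) (1 / (\<alpha> - 1)) < 1 / 2" by (simp add: divide_simps)
  then obtain \<mu> where "max (3 / (2 * \<alpha>)) (1 / (\<alpha> - 1)) < \<mu>" and l2: "\<mu> < 1 / 2" using dense by blast
  then have l: "3 / (2 * \<alpha>) < \<mu>" "1 / (\<alpha> - 1) < \<mu>" by auto
  have l0: "\<mu> > 0" using l(1) a3 by (meson divide_pos_pos less_trans mult_pos_pos zero_less_numeral)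
  have la: "3 / 2 < \<mu> * \<alpha>" "1 < \<mu> * (\<alpha> - 1)" using l a3 by (simp_all add: field_simps)
  \<comment> \<open>In \<open>\<mu> * (1 - \<eta>) * (\<alpha> - 1 - \<eta>)\<close> the terms
    linear in \<open>\<eta>\<close> sum to \<open>- \<eta> * \<mu> * \<alpha>\<close>. This choice
    uses up exactly the slack \<open>\<mu> * (\<alpha> - 1) - 1\<close>, and the square of
    \<open>\<eta>\<close> only helps.\<close>
  define \<eta> where "\<eta> = (\<mu> * (\<alpha> - 1) - 1) / (\<mu> * \<alpha>)"
  have eq: "\<eta> * (\<mu> * \<alpha>) = \<mu> * (\<alpha> - 1) - 1" unfolding \<eta>_def using l0 a3 by simp
  have e: "0 < \<eta>" "\<eta> < 1" unfolding \<eta>_def using la l0 a3 by (auto simp: field_simps)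
  have "\<mu> * (1 - \<eta>) * (\<alpha> - 1 - \<eta>) = \<mu> * (\<alpha> - 1) - \<eta> * (\<mu> * \<alpha>) + \<mu> * (\<eta> * \<eta>)" by (simp add: algebra_simps)
  also have "\<dots> \<ge> 1" unfolding eq using l0 e by simp
  finally have "1 \<le> \<mu> * (1 - \<eta>) * (\<alpha> - 1 - \<eta>)" .
  then show ?thesis using l0 l2 e la a3 True
    by (intro exI[of _ \<mu>] exI[of _ \<eta>] exI[of _ 0]) auto
next
  case False
  then have t1: "\<theta> < 1" using \<theta> by simp
  \<comment> \<open>Here \<open>\<mu> = 1/4\<close>. Then \<open>1 - \<eta> \<ge> 1/2\<close>, and
    for \<open>u \<le> \<alpha> / 32\<close> also
    \<open>\<alpha> - \<theta> * u - \<eta> \<ge> \<alpha> / 4\<close>; the product of 1/4, 1/2 and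
    \<open>\<alpha> / 4\<close> is the threshold \<open>\<alpha> / 32\<close>.\<close>
  define \<eta> where "\<eta> = min (1/2) (\<alpha> / 4)"
  have e: "0 < \<eta>" "\<eta> \<le> 1/2" "\<eta> \<le> \<alpha> / 4" unfolding \<eta>_def using \<alpha> by auto
  obtain S where S: "\<And>t. t \<ge> S \<Longrightarrow> t powr (\<theta> - 1) \<le> \<alpha> / 32"
    using powr_eventually_le[of "\<theta> - 1" "\<alpha> / 32"] t1 \<alpha> by auto
  have *: "3 / 2 * u \<le> 1/4 * \<alpha> \<and> \<eta> \<le> \<alpha> - \<theta> * u \<and> u \<le> 1/4 * (1 - \<eta>) * (\<alpha> - \<theta> * u - \<eta>)"
    if u: "0 \<le> u" "u \<le> \<alpha> / 32" for u
  proof -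
    have tu: "\<theta> * u \<le> u" using mult_right_mono[OF \<theta>(2) u(1)] by simp
    have "\<alpha> / 4 \<le> \<alpha> - \<theta> * u - \<eta>" using tu u e by linarith
    then have "1/2 * (\<alpha> / 4) \<le> (1 - \<eta>) * (\<alpha> - \<theta> * u - \<eta>)" using e \<alpha> by (intro mult_mono) auto
    then have "u \<le> 1/4 * ((1 - \<eta>) * (\<alpha> - \<theta> * u - \<eta>))" using u by linarith
    then have "u \<le> 1/4 * (1 - \<eta>) * (\<alpha> - \<theta> * u - \<eta>)" by (simp only: mult.assoc)
    moreover have "3 / 2 * u \<le> 1/4 * \<alpha>" "\<eta> \<le> \<alpha> - \<theta> * u" using tu u e \<alpha> by linarith+
    ultimately show ?thesis by blast
  qed
  show ?thesis
  proof (intro exI conjI allI impI)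
    show "(0::real) < 1/4" "1/4 * (1 + \<theta>) < 1" "0 < \<eta>" "\<eta> < 1" using e t1 by auto
    fix t assume "S \<le> t" "0 < t"
    then have "0 \<le> t powr (\<theta> - 1)" "t powr (\<theta> - 1) \<le> \<alpha> / 32" using S by auto
    from *[OF this] show "3 / 2 * t powr (\<theta> - 1) \<le> 1/4 * \<alpha>" "\<eta> \<le> \<alpha> - \<theta> * t powr (\<theta> - 1)"
      "t powr (\<theta> - 1) \<le> 1/4 * (1 - \<eta>) * (\<alpha> - \<theta> * t powr (\<theta> - 1) - \<eta>)" by blast+
  qed
qed

text \<open>The hypothesis on \<open>q\<close> is the discriminant condition; the bound is the
  arithmetic-geometric inequality for \<open>sqrt A * a\<close> and
  \<open>sqrt B * b\<close>.\<close>

lemma quadratic_form_nonneg: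
  fixes a b q A B :: real
  assumes "0 \<le> A" "0 \<le> B" "q\<^sup>2 \<le> A * B" "0 \<le> a" "0 \<le> b" "0 \<le> q"
  shows "q * (a * b) \<le> A * a\<^sup>2 / 2 + B * b\<^sup>2 / 2"
proof -
  have "q \<le> sqrt (A * B)" using assms by (simp add: real_le_rsqrt)
  then have "q * (a * b) \<le> sqrt (A * B) * (a * b)" using assms by (intro mult_right_mono) auto
  also have "\<dots> = (sqrt A * a) * (sqrt B * b)" by (simp add: real_sqrt_mult)
  also have "\<dots> \<le> ((sqrt A * a)\<^sup>2 + (sqrt B * b)\<^sup>2) / 2"
    using sum_squares_bound[of "sqrt A * a" "sqrt B * b"] by simp
  also have "\<dots> = A * a\<^sup>2 / 2 + B * b\<^sup>2 / 2" using assms by (simp add: power_mult_distrib)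
  finally show ?thesis .
qed

context damped_trajectory
begin

text \<open>Adding \<open>\<mu>\<close> times the weighted energy increment to the anchor increment,
  the damping absorbs the 3/2 from \<open>anchor_le\<close>, and the coefficient of
  \<open>t powr \<theta> * W t\<close> becomes \<open>\<mu> * (1 + \<theta>) - 1 = - c\<close>.
  Setting aside a share \<open>\<eta>\<close> of the diagonal terms still leaves enough to dominate
  the cross term.\<close>

lemma lyapunov:
  assumes z: "z \<in> argmin_set \<Phi>"
    and rem: "(\<lambda>t. (U z - (INF z. U z)) * (t powr \<theta> * \<epsilon> t)) absolutely_integrable_on {T..}"
  defines "h \<equiv> \<lambda>t. (norm (x t - z))\<^sup>2 / 2"
    and "\<kappa> \<equiv> \<lambda>t. t powr \<theta> * \<gamma> t - \<theta> * t powr (\<theta> - 1)"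
    and "r \<equiv> \<lambda>t. (U z - (INF z. U z)) * (t powr \<theta> * \<epsilon> t)"
  obtains \<mu> \<eta> c S E where "0 < \<mu>" "0 < \<eta>" "0 < c" "T \<le> S"
    and "E = (\<lambda>t. \<mu> * (t powr (1 + \<theta>) * W t) + t powr \<theta> * inner (x' t) (x t - z) + \<kappa> t * h t)"
    and "increment_le S E (\<lambda>t. r t + \<omega> t * h t - c * (t powr \<theta> * W t))"
    and "\<And>t. S \<le> t \<Longrightarrow> \<mu> * \<eta> * (t powr (1 + \<theta>) * W t) + \<eta> * h t \<le> E t"
    and "\<And>t. S \<le> t \<Longrightarrow> \<eta> \<le> \<kappa> t"
proof -
  obtain \<mu> \<eta> S0 where par: "0 < \<mu>" "\<mu> * (1 + \<theta>) < 1" "0 < \<eta>" "\<eta> < 1"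
    and S0: "\<And>t. t \<ge> S0 \<Longrightarrow> t > 0 \<Longrightarrow> 3 / 2 * t powr (\<theta> - 1) \<le> \<mu> * \<alpha> \<and>
      \<eta> \<le> \<alpha> - \<theta> * t powr (\<theta> - 1) \<and>
      t powr (\<theta> - 1) \<le> \<mu> * (1 - \<eta>) * (\<alpha> - \<theta> * t powr (\<theta> - 1) - \<eta>)"
    using lyapunov_parameters[OF \<theta> \<alpha>] by blast
  define S where "S = max S0 T"
  define c where "c = 1 - \<mu> * (1 + \<theta>)"
  define E where "E = (\<lambda>t. \<mu> * (t powr (1 + \<theta>) * W t) + t powr \<theta> * inner (x' t) (x t - z) + \<kappa> t * h t)"
  have powr_eqs: "t powr (1 + \<theta>) = t * t powr \<theta>" "t powr \<theta> = t * t powr (\<theta> - 1)" if "T \<le> t" for t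
    using that T by (simp_all add: powr_add powr_diff)
  have g: "\<alpha> \<le> t powr \<theta> * \<gamma> t" if "T \<le> t" for t
    using \<gamma>_lower[OF that] that T by (simp add: field_simps)
  have ST: "T \<le> t" "S0 \<le> t" "0 < t" if "S \<le> t" for t using that T unfolding S_def by auto
  have wtd: "increment_le T (\<lambda>t. t powr (1 + \<theta>) * W t)
     (\<lambda>t. (1 + \<theta>) * t powr \<theta> * W t - t powr (1 + \<theta>) * \<gamma> t * (norm (x' t))\<^sup>2)"
    by (rule weighted_energy_increment)
      (auto intro!: DERIV_cong[OF powr_deriv] continuous_intros powr_cont)
  note inc0 = increment_le_add[OF increment_le_cmult[OF wtd less_imp_le[OF par(1)]] anchor_increment[of z]]
  have inc: "increment_le S E (\<lambda>t. r t + \<omega> t * h t - c * (t powr \<theta> * W t))"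
  proof (rule increment_le_mono)
    show "increment_le S E (\<lambda>t. \<mu> * ((1 + \<theta>) * t powr \<theta> * W t - t powr (1 + \<theta>) * \<gamma> t * (norm (x' t))\<^sup>2) +
        (\<omega> t * ((norm (x t - z))\<^sup>2 / 2) +
          t powr \<theta> * ((norm (x' t))\<^sup>2 + inner (x'' t + \<gamma> t *\<^sub>R x' t) (x t - z))))"
      by (rule increment_le_cong[OF increment_le_subset[OF inc0, of S]])
        (auto simp: S_def E_def h_def \<kappa>_def)
    show "(\<lambda>t. r t + \<omega> t * h t - c * (t powr \<theta> * W t)) absolutely_integrable_on {s..t}"
      if "S \<le> s" "s \<le> t" for s t
    proof -
      have s: "T \<le> s" using that ST by blast
      have sub: "{s..t} \<subseteq> {T..}" using s by auto
      have "continuous_on {T..} h" "continuous_on {T..} (\<lambda>t. c * (t powr \<theta> * W t))"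
        unfolding h_def by (intro continuous_intros x_cont W_cont powr_cont; simp)+
      then have c: "continuous_on {s..t} h" "continuous_on {s..t} (\<lambda>t. c * (t powr \<theta> * W t))"
        using sub by (auto intro: continuous_on_subset)
      show ?thesis unfolding r_def
        by (intro set_integral_add set_integral_diff absolutely_integrable_continuous_mult
            absolutely_integrable_Ici_Icc[OF rem s] absolutely_integrable_Ici_Icc[OF \<omega>_integrable s]
            absolutely_integrable_continuous_real c)
    qed
    fix t assume "S \<le> t"
    note t = ST[OF this]
    define n where "n = (norm (x' t))\<^sup>2"
    have n0: "0 \<le> n" unfolding n_def by simp
    have tau: "0 < t powr \<theta>" using t by simp
    \<comment> \<open>Multiplied by \<open>t\<close> and the squared speed, this compares the
      kinetic term of weight \<open>t powr \<theta>\<close> with the damping of weight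
      \<open>t powr (1 + \<theta>)\<close>.\<close>
    have "3 / 2 * t powr (\<theta> - 1) \<le> \<mu> * (t powr \<theta> * \<gamma> t)"
      using S0[OF t(2,3)] mult_left_mono[OF g[OF t(1)] less_imp_le[OF par(1)]] by linarith
    then have "t * (3 / 2 * t powr (\<theta> - 1)) * n \<le> t * (\<mu> * (t powr \<theta> * \<gamma> t)) * n"
      using t n0 by (intro mult_right_mono mult_left_mono) auto
    then have damp: "3 / 2 * t powr \<theta> * n \<le> \<mu> * (t powr (1 + \<theta>) * \<gamma> t * n)"
      unfolding powr_eqs(1)[OF t(1)] by (subst powr_eqs(2)[OF t(1)]) (simp add: algebra_simps)
    have "t powr \<theta> * (n + inner (x'' t + \<gamma> t *\<^sub>R x' t) (x t - z)) \<le>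
        t powr \<theta> * (3 / 2 * n - W t + \<epsilon> t * (U z - (INF z. U z)))"
      unfolding n_def using tau by (intro mult_left_mono anchor_le z t) auto
    with damp have "\<mu> * ((1 + \<theta>) * t powr \<theta> * W t - t powr (1 + \<theta>) * \<gamma> t * n) + (\<omega> t * h t +
        t powr \<theta> * (n + inner (x'' t + \<gamma> t *\<^sub>R x' t) (x t - z))) \<le> r t + \<omega> t * h t - c * (t powr \<theta> * W t)"
      unfolding r_def c_def by (simp add: algebra_simps)
    then show "\<mu> * ((1 + \<theta>) * t powr \<theta> * W t - t powr (1 + \<theta>) * \<gamma> t * (norm (x' t))\<^sup>2) +
        (\<omega> t * ((norm (x t - z))\<^sup>2 / 2) +
          t powr \<theta> * ((norm (x' t))\<^sup>2 + inner (x'' t + \<gamma> t *\<^sub>R x' t) (x t - z))) \<le>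
        r t + \<omega> t * h t - c * (t powr \<theta> * W t)" unfolding n_def h_def .
  qed
  have kap: "\<alpha> - \<theta> * t powr (\<theta> - 1) \<le> \<kappa> t" if "T \<le> t" for t using g[OF that] unfolding \<kappa>_def by simp
  have kap_eta: "\<eta> \<le> \<kappa> t" if "S \<le> t" for t using S0[OF ST(2,3)[OF that]] kap[OF ST(1)[OF that]] by linarith
  have low: "\<mu> * \<eta> * (t powr (1 + \<theta>) * W t) + \<eta> * h t \<le> E t" if St: "S \<le> t" for t
  proof -
    note t = ST[OF St]
    \<comment> \<open>\<open>A\<close> and \<open>B\<close> are the coefficients of \<open>W\<close>
      and \<open>h\<close> that remain after removing the lower bound to be proved; the cross term
      has coefficient \<open>t powr \<theta>\<close>, whose square must not exceed
      \<open>A * B\<close>.\<close>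
    define A where "A = \<mu> * (1 - \<eta>) * t powr (1 + \<theta>)"
    define B where "B = \<kappa> t - \<eta>"
    have A0: "0 \<le> A" and B0: "0 \<le> B" using par kap_eta[OF St] unfolding A_def B_def by auto
    have tau: "0 < t powr \<theta>" using t by simp
    have "t powr (\<theta> - 1) \<le> \<mu> * (1 - \<eta>) * (\<alpha> - \<theta> * t powr (\<theta> - 1) - \<eta>)" using S0[OF t(2,3)] by blast
    also have "\<dots> \<le> \<mu> * (1 - \<eta>) * B"
      unfolding B_def using par kap[OF t(1)] by (intro mult_left_mono) auto
    finally have "t powr (1 + \<theta>) * t powr (\<theta> - 1) \<le> t powr (1 + \<theta>) * (\<mu> * (1 - \<eta>) * B)"
      by (intro mult_left_mono) auto
    also have "t powr (1 + \<theta>) * t powr (\<theta> - 1) = (t powr \<theta>)\<^sup>2"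
      using t by (simp add: powr_add[symmetric] power2_eq_square)
    finally have q: "(t powr \<theta>)\<^sup>2 \<le> A * B" unfolding A_def by (simp add: mult_ac)
    have "- (t powr \<theta> * inner (x' t) (x t - z)) \<le> t powr \<theta> * (norm (x' t) * norm (x t - z))"
      using mult_left_mono[OF Cauchy_Schwarz_ineq2[of "x' t" "x t - z"] less_imp_le[OF tau]] tau
      by (smt (verit) mult_minus_right mult_left_mono)
    also have "\<dots> \<le> A * (norm (x' t))\<^sup>2 / 2 + B * (norm (x t - z))\<^sup>2 / 2"
      using tau by (intro quadratic_form_nonneg A0 B0 q) auto
    also have "\<dots> \<le> A * W t + B * h t"
      using mult_left_mono[OF W_ge(1)[OF t(1)] A0] unfolding h_def by simp
    finally show ?thesis unfolding E_def A_def B_def by (simp add: algebra_simps)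
  qed
  have "0 < c" "T \<le> S" using par unfolding c_def S_def by auto
  from that[OF par(1,3) this E_def inc low kap_eta] show ?thesis by blast
qed

lemma weighted_W_cont: "continuous_on {T..} (\<lambda>t. t powr \<theta> * W t)"
  by (intro continuous_intros powr_cont W_cont)

text \<open>Since \<open>W\<close> is nonincreasing, the integral over \<open>[t/2, t]\<close> is at
  least \<open>(t/2) powr (1 + \<theta>) * W t\<close>, and these integrals tend to 0. Halving
  \<open>t\<close> costs at most a factor 4 because \<open>1 + \<theta> \<le> 2\<close>.\<close>

lemma weighted_W_tendsto_0:
  assumes int: "(\<lambda>t. t powr \<theta> * W t) absolutely_integrable_on {T..}"
  shows "((\<lambda>t. t powr (1 + \<theta>) * W t) \<longlongrightarrow> 0) at_top"
proof (rule tendstoI)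
  fix e :: real assume e: "e > 0"
  have nn: "0 \<le> t powr \<theta> * W t" if "T \<le> t" for t using W_nonneg[OF that] by simp
  obtain S where S: "T \<le> S" "\<And>s t. S \<le> s \<Longrightarrow> s \<le> t \<Longrightarrow> integral {s..t} (\<lambda>t. t powr \<theta> * W t) < e / 4"
    using integral_small_tail[OF int nn, of "e/4"] e by auto
  show "eventually (\<lambda>t. dist (t powr (1 + \<theta>) * W t) 0 < e) at_top"
    using eventually_ge_at_top[of "2 * S"]
  proof eventually_elim
    fix t assume t: "2 * S \<le> t"
    define s where "s = t / 2"
    have s: "S \<le> s" "s \<le> t" "T \<le> s" "0 < s" "T \<le> t" using t S(1) T unfolding s_def by auto
    have "s * (s powr \<theta> * W t) = integral {s..t} (\<lambda>_. s powr \<theta> * W t)"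
      using s by (simp add: s_def)
    also have "\<dots> \<le> integral {s..t} (\<lambda>t. t powr \<theta> * W t)"
    proof (rule integral_le)
      show "(\<lambda>t. t powr \<theta> * W t) integrable_on {s..t}"
        using absolutely_integrable_Ici_Icc[OF int s(3)] by (rule set_lebesgue_integral_eq_integral(1))
      fix r assume r: "r \<in> {s..t}"
      show "s powr \<theta> * W t \<le> r powr \<theta> * W r"
        using r s \<theta> W_antimono[of r t] W_nonneg[OF s(5)] by (intro mult_mono powr_mono2) auto
    qed auto
    also have "\<dots> < e / 4" by (rule S(2)[OF s(1,2)])
    finally have 1: "4 * (s powr (1 + \<theta>) * W t) < e" using s by (simp add: powr_add)
    have "t powr (1 + \<theta>) = 2 powr (1 + \<theta>) * s powr (1 + \<theta>)"
      using s by (subst powr_mult[symmetric]) (auto simp: s_def)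
    also have "\<dots> \<le> 2 powr 2 * s powr (1 + \<theta>)"
      using \<theta> by (intro mult_right_mono powr_mono) auto
    finally have "t powr (1 + \<theta>) \<le> 4 * s powr (1 + \<theta>)" by simp
    then have "t powr (1 + \<theta>) * W t \<le> 4 * s powr (1 + \<theta>) * W t"
      using W_nonneg[OF s(5)] by (rule mult_right_mono)
    with 1 W_nonneg[OF s(5)] show "dist (t powr (1 + \<theta>) * W t) 0 < e"
      by (simp add: dist_real_def)
  qed
qed

text \<open>The Lyapunov inequality is used twice: first with Gronwall to bound \<open>E\<close> and
  so \<open>h\<close>, then with \<open>\<omega> * h\<close> as an integrable remainder, which makes
  \<open>t powr \<theta> * W t\<close> integrable and \<open>E\<close> convergent. The energy and
  cross terms of \<open>E\<close> vanish in the limit, and dividing by the limit of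
  \<open>\<kappa>\<close> isolates \<open>h\<close>.\<close>

lemma energy_and_anchor:
  assumes z: "z \<in> argmin_set \<Phi>"
    and rem: "(\<lambda>t. (U z - (INF z. U z)) * (t powr \<theta> * \<epsilon> t)) absolutely_integrable_on {T..}"
  shows "(\<lambda>t. t powr \<theta> * W t) absolutely_integrable_on {T..}"
    and "\<exists>l. ((\<lambda>t. (norm (x t - z))\<^sup>2) \<longlongrightarrow> l) at_top"
proof -
  define h where "h = (\<lambda>t. (norm (x t - z))\<^sup>2 / 2)"
  define \<kappa> where "\<kappa> = (\<lambda>t. t powr \<theta> * \<gamma> t - \<theta> * t powr (\<theta> - 1))"
  define r where "r = (\<lambda>t. (U z - (INF z. U z)) * (t powr \<theta> * \<epsilon> t))"
  obtain \<mu> \<eta> c S E where par: "0 < \<mu>" "0 < \<eta>" "0 < c" and S: "T \<le> S"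
    and E: "E = (\<lambda>t. \<mu> * (t powr (1 + \<theta>) * W t) + t powr \<theta> * inner (x' t) (x t - z) + \<kappa> t * h t)"
    and inc: "increment_le S E (\<lambda>t. r t + \<omega> t * h t - c * (t powr \<theta> * W t))"
    and low: "\<And>t. S \<le> t \<Longrightarrow> \<mu> * \<eta> * (t powr (1 + \<theta>) * W t) + \<eta> * h t \<le> E t"
    and kap: "\<And>t. S \<le> t \<Longrightarrow> \<eta> \<le> \<kappa> t"
    using lyapunov[OF z rem] unfolding h_def \<kappa>_def r_def by blast
  have h0: "0 \<le> h t" for t unfolding h_def by simp
  have W0: "0 \<le> t powr a * W t" if "S \<le> t" for t a using W_nonneg[of t] that S by simp
  have hE: "\<eta> * h t \<le> E t" and E0: "0 \<le> E t" if "S \<le> t" for t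
  proof -
    have "0 \<le> \<mu> * \<eta> * (t powr (1 + \<theta>) * W t)" using par W0[OF that] by simp
    then show "\<eta> * h t \<le> E t" using low[OF that] by linarith
    moreover have "0 \<le> \<eta> * h t" using par h0[of t] by simp
    ultimately show "0 \<le> E t" by linarith
  qed
  have sub: "{S..} \<subseteq> {T..}" using S by auto
  have r0: "0 \<le> r t" if "S \<le> t" for t
    using \<epsilon>_pos[of t] Inf_U_le[of z] that S unfolding r_def by (intro mult_nonneg_nonneg) auto
  have rS: "r absolutely_integrable_on {S..}" and wS: "\<omega> absolutely_integrable_on {S..}"
    unfolding r_def using rem \<omega>_integrable sub by (auto intro: set_integrable_subset)
  have "continuous_on {T..} E" unfolding E h_def \<kappa>_def
    by (intro continuous_intros x_cont x'_cont W_cont powr_cont \<gamma>_cont; simp)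
  then have cE: "continuous_on {S..} E" by (rule continuous_on_subset[OF _ sub])
  \<comment> \<open>The energy term is dropped and \<open>h\<close> is replaced by
    \<open>E / \<eta>\<close>, which gives the shape required by the Gronwall estimate.\<close>
  have "increment_le S E (\<lambda>t. r t + (\<omega> t / \<eta>) * E t)"
  proof (rule increment_le_mono[OF inc])
    show "(\<lambda>t. r t + \<omega> t / \<eta> * E t) absolutely_integrable_on {s..t}" if "S \<le> s" "s \<le> t" for s t
    proof -
      have "continuous_on {s..t} (\<lambda>t. E t / \<eta>)"
        by (intro continuous_intros continuous_on_subset[OF cE]) (use that par in auto)
      from absolutely_integrable_continuous_mult[OF absolutely_integrable_Ici_Icc[OF wS that(1)] this]
      show ?thesis by (intro set_integral_add absolutely_integrable_Ici_Icc[OF rS that(1)]) simp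
    qed
    fix t assume t: "S \<le> t"
    have "h t \<le> E t / \<eta>" using hE[OF t] par by (simp add: field_simps)
    from mult_left_mono[OF this \<omega>_nonneg[of t]] have "\<omega> t * h t \<le> \<omega> t / \<eta> * E t" by simp
    moreover have "0 \<le> c * (t powr \<theta> * W t)" using par W0[OF t] by simp
    ultimately show "r t + \<omega> t * h t - c * (t powr \<theta> * W t) \<le> r t + \<omega> t / \<eta> * E t" by linarith
  qed
  then have "\<exists>M. \<forall>t\<ge>S. E t \<le> M"
  proof (rule increment_le_gronwall_bounded[OF _ cE E0 rS r0])
    show "(\<lambda>t. \<omega> t / \<eta>) absolutely_integrable_on {S..}" using wS by (intro set_integrable_divide) simp
    show "0 \<le> \<omega> t / \<eta>" for t using \<omega>_nonneg par by simp
  qed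
  then obtain M where M: "\<And>t. S \<le> t \<Longrightarrow> E t \<le> M" by blast
  define H where "H = M / \<eta>"
  have hH: "h t \<le> H" if "S \<le> t" for t
    using hE[OF that] M[OF that] par unfolding H_def by (simp add: field_simps)
  have H0: "0 \<le> H" using hH[of S] h0[of S] by simp
  \<comment> \<open>With \<open>h\<close> bounded by \<open>H\<close>, the term
    \<open>\<omega> * h\<close> becomes part of the integrable remainder.\<close>
  define r2 where "r2 = (\<lambda>t. r t + \<omega> t * H)"
  have r2: "r2 absolutely_integrable_on {S..}" "\<And>t. S \<le> t \<Longrightarrow> 0 \<le> r2 t"
    unfolding r2_def using rS wS r0 \<omega>_nonneg H0 by auto
  have cW: "continuous_on {S..} (\<lambda>t. t powr \<theta> * W t)"
    by (rule continuous_on_subset[OF weighted_W_cont sub])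
  have cWint: "(\<lambda>t. t powr \<theta> * W t) absolutely_integrable_on {s..t}" if "S \<le> s" for s t
    by (intro absolutely_integrable_continuous_real continuous_on_subset[OF cW]) (use that in auto)
  have inc2: "increment_le S E (\<lambda>t. r2 t - c * (t powr \<theta> * W t))"
  proof (rule increment_le_mono[OF inc])
    show "(\<lambda>t. r2 t - c * (t powr \<theta> * W t)) absolutely_integrable_on {s..t}" if "S \<le> s" "s \<le> t" for s t
      by (intro set_integral_diff set_integrable_mult_right absolutely_integrable_Ici_Icc[OF r2(1)]
          cWint that)
    show "r t + \<omega> t * h t - c * (t powr \<theta> * W t) \<le> r2 t - c * (t powr \<theta> * W t)" if "S \<le> t" for t
      using mult_left_mono[OF hH[OF that] \<omega>_nonneg[of t]] unfolding r2_def by simp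
  qed
  have "(\<lambda>t. t powr \<theta> * W t) absolutely_integrable_on {S..}"
  proof (rule absolutely_integrable_Ici_bounded[OF cW W0])
    fix t assume t: "S \<le> t"
    note li = set_lebesgue_integral_eq_integral(1)
    have "E t - E S \<le> integral {S..t} (\<lambda>t. r2 t - c * (t powr \<theta> * W t))"
      by (rule increment_leD(3)[OF inc2 order_refl t])
    also have "\<dots> = integral {S..t} r2 - c * integral {S..t} (\<lambda>t. t powr \<theta> * W t)"
      by (subst integral_diff)
        (auto intro!: li[OF absolutely_integrable_Ici_Icc[OF r2(1)]] integrable_on_mult_right li[OF cWint])
    also have "integral {S..t} r2 \<le> integral {S..} r2" by (rule integral_Icc_le_Ici[OF r2]) auto
    finally have "c * integral {S..t} (\<lambda>t. t powr \<theta> * W t) \<le> E S + integral {S..} r2"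
      using E0[OF t] by linarith
    then show "integral {S..t} (\<lambda>t. t powr \<theta> * W t) \<le> (E S + integral {S..} r2) / c"
      using par by (simp add: field_simps)
  qed
  then show int: "(\<lambda>t. t powr \<theta> * W t) absolutely_integrable_on {T..}"
    by (rule absolutely_integrable_Ici_extend[OF weighted_W_cont])
  have Wlim: "((\<lambda>t. t powr (1 + \<theta>) * W t) \<longlongrightarrow> 0) at_top" by (rule weighted_W_tendsto_0[OF int])
  have "increment_le S E r2"
  proof (rule increment_le_mono[OF inc2])
    show "r2 t - c * (t powr \<theta> * W t) \<le> r2 t" if "S \<le> t" for t using par W0[OF that] by simp
  qed (rule absolutely_integrable_Ici_Icc[OF r2(1)])
  from increment_le_tendsto[where m = 0, OF this E0 r2] obtain L where L: "(E \<longlongrightarrow> L) at_top" by blast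
  \<comment> \<open>By Cauchy-Schwarz and \<open>2 * \<theta> \<le> 1 + \<theta>\<close> the square
    is at most \<open>4 * H * t powr (1 + \<theta>) * W t\<close>: the squared speed is at most
    \<open>2 * W t\<close>, the squared distance at most \<open>2 * H\<close>.\<close>
  have "((\<lambda>t. t powr \<theta> * inner (x' t) (x t - z)) \<longlongrightarrow> 0) at_top"
  proof (rule Lim_null_comparison)
    have "((\<lambda>t. sqrt (4 * H * (t powr (1 + \<theta>) * W t))) \<longlongrightarrow> sqrt (4 * H * 0)) at_top"
      by (intro tendsto_intros Wlim)
    then show "((\<lambda>t. sqrt (4 * H * (t powr (1 + \<theta>) * W t))) \<longlongrightarrow> 0) at_top" by simp
    show "eventually (\<lambda>t. norm (t powr \<theta> * inner (x' t) (x t - z)) \<le> sqrt (4 * H * (t powr (1 + \<theta>) * W t))) at_top"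
      using eventually_ge_at_top[of S]
    proof eventually_elim
      fix t assume t: "S \<le> t"
      have tT: "T \<le> t" "1 \<le> t" using t S T by auto
      have "(t powr \<theta> * inner (x' t) (x t - z))\<^sup>2 = (t powr \<theta>)\<^sup>2 * (inner (x' t) (x t - z))\<^sup>2"
        by (simp add: power_mult_distrib)
      also have "\<dots> \<le> t powr (1 + \<theta>) * ((norm (x' t))\<^sup>2 * (norm (x t - z))\<^sup>2)"
      proof (rule mult_mono)
        show "(t powr \<theta>)\<^sup>2 \<le> t powr (1 + \<theta>)"
          using tT \<theta> by (auto simp: power2_eq_square powr_add[symmetric] intro!: powr_mono)
        show "(inner (x' t) (x t - z))\<^sup>2 \<le> (norm (x' t))\<^sup>2 * (norm (x t - z))\<^sup>2"
          using Cauchy_Schwarz_ineq[of "x' t" "x t - z"] by (simp add: power2_norm_eq_inner)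
      qed auto
      also have "\<dots> \<le> t powr (1 + \<theta>) * ((2 * W t) * (2 * H))"
        using W_ge(1)[OF tT(1)] hH[OF t] W_nonneg[OF tT(1)] unfolding h_def
        by (intro mult_left_mono mult_mono) auto
      also have "\<dots> = 4 * H * (t powr (1 + \<theta>) * W t)" by simp
      finally show "norm (t powr \<theta> * inner (x' t) (x t - z)) \<le> sqrt (4 * H * (t powr (1 + \<theta>) * W t))"
        by (simp add: real_le_rsqrt)
    qed
  qed
  from tendsto_diff[OF tendsto_diff[OF L tendsto_mult_left[OF Wlim, of \<mu>]] this]
  have kh: "((\<lambda>t. \<kappa> t * h t) \<longlongrightarrow> L) at_top" unfolding E by simp
  \<comment> \<open>A positive function whose upward increments are bounded by integrals of an
    integrable function converges.\<close>
  have "\<exists>G. ((\<lambda>t. t powr \<theta> * \<gamma> t) \<longlongrightarrow> G) at_top"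
  proof (rule increment_le_tendsto[OF \<gamma>_inc _ p(1) p(2)])
    show "0 \<le> t powr \<theta> * \<gamma> t" if "T \<le> t" for t using \<gamma>_pos[OF that] by simp
  qed
  moreover have "\<exists>G. ((\<lambda>t. \<theta> * t powr (\<theta> - 1)) \<longlongrightarrow> G) at_top"
  proof (cases "\<theta> = 1")
    case True
    have "eventually (\<lambda>t. \<theta> * t powr (\<theta> - 1) = 1) at_top"
      using eventually_gt_at_top[of 0] by eventually_elim (simp add: True)
    then show ?thesis by (intro exI tendsto_eventually)
  next
    case False
    then have "((\<lambda>t::real. t powr (\<theta> - 1)) \<longlongrightarrow> 0) at_top"
      using \<theta> by (intro tendsto_neg_powr filterlim_ident) auto
    from tendsto_mult_left[OF this] show ?thesis by blast
  qed
  ultimately obtain G G' where "((\<lambda>t. t powr \<theta> * \<gamma> t) \<longlongrightarrow> G) at_top"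
    "((\<lambda>t. \<theta> * t powr (\<theta> - 1)) \<longlongrightarrow> G') at_top" by blast
  from tendsto_diff[OF this] obtain K where K: "(\<kappa> \<longlongrightarrow> K) at_top" unfolding \<kappa>_def by blast
  \<comment> \<open>The limit of \<open>\<kappa>\<close> stays positive, so convergence of
    \<open>\<kappa> * h\<close> passes to \<open>h\<close>.\<close>
  have "\<eta> \<le> K"
    by (rule tendsto_lowerbound[OF K]) (use kap in \<open>auto simp: eventually_at_top_linorder\<close>)
  then have "((\<lambda>t. \<kappa> t * h t / \<kappa> t) \<longlongrightarrow> L / K) at_top" using par by (intro tendsto_divide kh K) auto
  moreover have "eventually (\<lambda>t. \<kappa> t * h t / \<kappa> t = h t) at_top"
    using eventually_ge_at_top[of S] by eventually_elim (use kap par in fastforce)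
  ultimately have "(h \<longlongrightarrow> L / K) at_top" by (rule Lim_transform_eventually)
  from tendsto_mult_left[OF this, of 2] show "\<exists>l. ((\<lambda>t. (norm (x t - z))\<^sup>2) \<longlongrightarrow> l) at_top"
    unfolding h_def by auto
qed

end

section \<open>Identification of the weak limits\<close>

text \<open>Sublevel sets of \<open>f\<close> are closed and convex, so the set at level
  \<open>m + e\<close> contains the closed convex hull of a late tail.\<close>

lemma convex_value_le_limit_on_tail_hulls:
  fixes X :: "real \<Rightarrow> 'a::real_inner" and f :: "'a \<Rightarrow> real"
  assumes cv: "convex_on UNIV f" and cont: "continuous_on UNIV f"
    and lim: "((\<lambda>t. f (X t)) \<longlongrightarrow> m) at_top"
    and q: "\<And>T. q \<in> closure (convex hull (X ` {T..}))"
  shows "f q \<le> m"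
proof (rule field_le_epsilon)
  fix e :: real assume e: "e > 0"
  obtain T where T: "\<And>t. t \<ge> T \<Longrightarrow> f (X t) < m + e"
    using order_tendstoD(2)[OF lim, of "m + e"] e by (auto simp: eventually_at_top_linorder)
  have "convex {z. f z \<le> m + e}"
  proof (rule convexI)
    fix a b and u v :: real
    assume h: "a \<in> {z. f z \<le> m + e}" "b \<in> {z. f z \<le> m + e}" "0 \<le> u" "0 \<le> v" "u + v = 1"
    have "f (u *\<^sub>R a + v *\<^sub>R b) \<le> u * f a + v * f b"
      using cv h(3-5) unfolding convex_on_def by blast
    also have "\<dots> \<le> u * (m + e) + v * (m + e)" using h by (intro add_mono mult_left_mono) auto
    also have "\<dots> = m + e" using h(5) by (simp add: distrib_right[symmetric])
    finally show "u *\<^sub>R a + v *\<^sub>R b \<in> {z. f z \<le> m + e}" by simp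
  qed
  moreover have "closed {z. f z \<le> m + e}"
    using closed_Collect_le[OF cont, of "\<lambda>_. m + e"] by simp
  moreover have "X ` {T..} \<subseteq> {z. f z \<le> m + e}" using T by (auto intro: less_imp_le)
  ultimately have "closure (convex hull (X ` {T..})) \<subseteq> {z. f z \<le> m + e}"
    by (intro closure_minimal hull_minimal)
  then show "f q \<le> m + e" using q[of T] by blast
qed

lemma C1_gradient_continuous_on: "C1_gradient f g \<Longrightarrow> continuous_on UNIV f"
  unfolding C1_gradient_def gderiv_def
  by (auto intro!: has_derivative_continuous continuous_at_imp_continuous_on)

context damped_trajectory
begin

text \<open>This supplies the tail hypothesis of Opial's lemma: the gap of \<open>\<Phi>\<close>
  lies between 0 and \<open>W t\<close>, which is at most \<open>t powr (1 + \<theta>) * W t\<close>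
  because \<open>t \<ge> 1\<close>.\<close>

lemma tails_argmin_\<Phi>:
  assumes Wlim: "((\<lambda>t. t powr (1 + \<theta>) * W t) \<longlongrightarrow> 0) at_top"
    and q: "\<And>S. q \<in> closure (convex hull (x ` {S..}))"
  shows "q \<in> argmin_set \<Phi>"
proof -
  have "((\<lambda>t. \<Phi> (x t) - (INF z. \<Phi> z)) \<longlongrightarrow> 0) at_top"
  proof (rule tendsto_sandwich[OF _ _ tendsto_const Wlim])
    show "eventually (\<lambda>t. 0 \<le> \<Phi> (x t) - (INF z. \<Phi> z)) at_top" using Inf_\<Phi>_le by simp
    show "eventually (\<lambda>t. \<Phi> (x t) - (INF z. \<Phi> z) \<le> t powr (1 + \<theta>) * W t) at_top"
      using eventually_ge_at_top[of T]
    proof eventually_elim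
      fix t assume t: "T \<le> t"
      have "1 * W t \<le> t powr (1 + \<theta>) * W t"
        using t T \<theta> W_nonneg[OF t] by (intro mult_right_mono ge_one_powr_ge_zero) auto
      then show "\<Phi> (x t) - (INF z. \<Phi> z) \<le> t powr (1 + \<theta>) * W t" using W_ge(2)[OF t] by simp
    qed
  qed
  then have "((\<lambda>t. \<Phi> (x t)) \<longlongrightarrow> (INF z. \<Phi> z)) at_top" by (simp add: LIM_zero_iff)
  from convex_value_le_limit_on_tail_hulls[OF convex_\<Phi> C1_gradient_continuous_on[OF grad_\<Phi>] this q]
  show ?thesis using Inf_\<Phi>_le[of q] by (simp add: argmin_set_def)
qed

text \<open>A positive \<open>c\<close> below the lower limit turns
  \<open>\<epsilon> t * (U (x t) - inf U) \<le> W t\<close> into a bound of the gap of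
  \<open>U\<close> by \<open>t powr (1 + \<theta>) * W t / c\<close>.\<close>

lemma tails_argmin_U:
  assumes Wlim: "((\<lambda>t. t powr (1 + \<theta>) * W t) \<longlongrightarrow> 0) at_top"
    and \<epsilon>_liminf: "Liminf at_top (\<lambda>t. ereal (t powr (1 + \<theta>) * \<epsilon> t)) > 0"
    and q: "\<And>S. q \<in> closure (convex hull (x ` {S..}))"
  shows "q \<in> argmin_set U"
proof -
  obtain c where c: "0 < ereal c" "ereal c < Liminf at_top (\<lambda>t. ereal (t powr (1 + \<theta>) * \<epsilon> t))"
    using ereal_dense2[OF \<epsilon>_liminf] by blast
  have ev: "eventually (\<lambda>t. c < t powr (1 + \<theta>) * \<epsilon> t) at_top"
    using less_LiminfD[OF c(2)] by simp
  have c0: "0 < c" using c(1) by simp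
  have "((\<lambda>t. U (x t) - (INF z. U z)) \<longlongrightarrow> 0) at_top"
  proof (rule tendsto_sandwich[OF _ _ tendsto_const])
    show "((\<lambda>t. t powr (1 + \<theta>) * W t / c) \<longlongrightarrow> 0) at_top"
      using tendsto_divide[OF Wlim tendsto_const[of c]] c0 by simp
    show "eventually (\<lambda>t. 0 \<le> U (x t) - (INF z. U z)) at_top" using Inf_U_le by simp
    show "eventually (\<lambda>t. U (x t) - (INF z. U z) \<le> t powr (1 + \<theta>) * W t / c) at_top"
      using eventually_ge_at_top[of T] ev
    proof eventually_elim
      fix t assume t: "T \<le> t" "c < t powr (1 + \<theta>) * \<epsilon> t"
      let ?Y = "U (x t) - (INF z. U z)"
      have "c * ?Y \<le> t powr (1 + \<theta>) * \<epsilon> t * ?Y"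
        using t(2) Inf_U_le[of "x t"] by (intro mult_right_mono) auto
      also have "\<dots> \<le> t powr (1 + \<theta>) * W t"
        using W_ge(3)[OF t(1)] by (simp add: mult.assoc mult_left_mono)
      finally show "?Y \<le> t powr (1 + \<theta>) * W t / c" using c0 by (simp add: pos_le_divide_eq mult.commute)
    qed
  qed
  then have "((\<lambda>t. U (x t)) \<longlongrightarrow> (INF z. U z)) at_top" by (simp add: LIM_zero_iff)
  from convex_value_le_limit_on_tail_hulls[OF convex_U C1_gradient_continuous_on[OF grad_U] this q]
  show ?thesis using Inf_U_le[of q] by (simp add: argmin_set_def)
qed

lemma W_smallo:
  assumes "((\<lambda>t. t powr (1 + \<theta>) * W t) \<longlongrightarrow> 0) at_top"
  shows "W \<in> o[at_top](\<lambda>t. 1 / t powr (1 + \<theta>))"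
proof (rule smalloI_tendsto)
  show "((\<lambda>t. W t / (1 / t powr (1 + \<theta>))) \<longlongrightarrow> 0) at_top" using assms by (simp add: mult.commute)
  show "eventually (\<lambda>t::real. 1 / t powr (1 + \<theta>) \<noteq> 0) at_top"
    using eventually_gt_at_top[of 0] by eventually_elim simp
qed

text \<open>The remainder is a constant multiple of \<open>t powr \<theta> * \<epsilon> t\<close>,
  so every minimizer of \<open>\<Phi>\<close> can serve as anchor in Opial's lemma.\<close>

lemma converges_if_\<epsilon>_integrable:
  assumes ne: "argmin_set \<Phi> \<noteq> {}"
    and \<epsilon>_int: "(\<lambda>t. t powr \<theta> * \<epsilon> t) absolutely_integrable_on {T..}"
  shows "(\<exists>z\<in>argmin_set \<Phi>. converges_weakly x z) \<and> W \<in> o[at_top](\<lambda>t. 1 / t powr (1 + \<theta>)) \<and>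
    (\<lambda>t. t powr \<theta> * W t) absolutely_integrable_on {T..}"
proof -
  have rem: "(\<lambda>t. (U z - (INF z. U z)) * (t powr \<theta> * \<epsilon> t)) absolutely_integrable_on {T..}" for z
    by (rule set_integrable_mult_right) (rule \<epsilon>_int)
  obtain z where z: "z \<in> argmin_set \<Phi>" using ne by blast
  note int = energy_and_anchor(1)[OF z rem]
  note lim = weighted_W_tendsto_0[OF int]
  have "\<exists>z\<in>argmin_set \<Phi>. converges_weakly x z"
    by (rule opial[OF ne energy_and_anchor(2)[OF _ rem] tails_argmin_\<Phi>[OF lim]])
  with int W_smallo[OF lim] show ?thesis by blast
qed

text \<open>For an anchor that also minimizes \<open>U\<close> the remainder is identically zero, so
  Opial's lemma is applied to the common minimizers.\<close>

lemma converges_if_\<epsilon>_liminf_pos: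
  assumes ne: "argmin_set \<Phi> \<inter> argmin_set U \<noteq> {}"
    and \<epsilon>_liminf: "Liminf at_top (\<lambda>t. ereal (t powr (1 + \<theta>) * \<epsilon> t)) > 0"
  shows "(\<exists>z\<in>argmin_set \<Phi> \<inter> argmin_set U. converges_weakly x z) \<and>
    W \<in> o[at_top](\<lambda>t. 1 / t powr (1 + \<theta>)) \<and>
    (\<lambda>t. t powr \<theta> * W t) absolutely_integrable_on {T..}"
proof -
  have rem: "(\<lambda>t. (U z - (INF z. U z)) * (t powr \<theta> * \<epsilon> t)) absolutely_integrable_on {T..}"
    if "z \<in> argmin_set \<Phi> \<inter> argmin_set U" for z
    using that by (simp add: argmin_set_def absolutely_integrable_on_def)
  obtain z where z: "z \<in> argmin_set \<Phi> \<inter> argmin_set U" using ne by blast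
  note int = energy_and_anchor(1)[OF IntD1[OF z] rem[OF z]]
  note lim = weighted_W_tendsto_0[OF int]
  have "\<exists>z\<in>argmin_set \<Phi> \<inter> argmin_set U. converges_weakly x z"
  proof (rule opial[OF ne])
    show "\<exists>l. ((\<lambda>t. (norm (x t - z))\<^sup>2) \<longlongrightarrow> l) at_top" if "z \<in> argmin_set \<Phi> \<inter> argmin_set U" for z
      by (rule energy_and_anchor(2)[OF IntD1[OF that] rem[OF that]])
  qed (intro IntI tails_argmin_\<Phi>[OF lim] tails_argmin_U[OF lim \<epsilon>_liminf])
  with int W_smallo[OF lim] show ?thesis by blast
qed

end

section \<open>From the almost everywhere hypotheses to the half-line theorem\<close>

text \<open>On compact intervals away from 0 the power is Lipschitz, so its product with
  \<open>\<gamma>\<close> is absolutely continuous. Where \<open>\<gamma>\<close> is differentiable,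
  \<open>deriv\<close> is the actual derivative of the product, and the remaining points form a null
  set.\<close>

lemma powr_mult_increment_le:
  fixes \<gamma> :: "real \<Rightarrow> real"
  assumes t0: "0 < t0" and ac: "locally_absolutely_continuous_from t0 \<gamma>" and S: "t0 \<le> S"
    and diff: "AE t in lebesgue. S \<le> t \<longrightarrow> \<gamma> differentiable at t"
    and int: "(\<lambda>t. max 0 (deriv (\<lambda>s. s powr \<theta> * \<gamma> s) t)) absolutely_integrable_on {S..}"
  shows "increment_le S (\<lambda>t. t powr \<theta> * \<gamma> t) (\<lambda>t. max 0 (deriv (\<lambda>s. s powr \<theta> * \<gamma> s) t))"
proof (rule increment_leI)
  let ?p = "\<lambda>t. max 0 (deriv (\<lambda>s. s powr \<theta> * \<gamma> s) t)"
  fix s t assume st: "S \<le> s" "s \<le> t"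
  show p: "?p absolutely_integrable_on {s..t}" by (rule absolutely_integrable_Ici_Icc[OF int st(1)])
  obtain N where N: "{t. \<not> (S \<le> t \<longrightarrow> \<gamma> differentiable at t)} \<subseteq> N" "N \<in> null_sets lebesgue"
    using diff unfolding eventually_ae_filter by auto
  have s0: "0 < s" using t0 S st by simp
  have pd: "((\<lambda>r. r powr \<theta>) has_real_derivative \<theta> * r powr (\<theta> - 1)) (at r within A)"
    if "s \<le> r" for r A
    using has_real_derivative_powr[of r \<theta>] that s0 by (auto intro: has_field_derivative_at_within)
  have "compact ((\<lambda>r. \<theta> * r powr (\<theta> - 1)) ` {s..t})"
    using s0 by (intro compact_continuous_image continuous_intros) auto
  then obtain L where L: "\<And>r. r \<in> {s..t} \<Longrightarrow> norm (\<theta> * r powr (\<theta> - 1)) \<le> L"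
    by (meson bounded_iff compact_imp_bounded imageI)
  have lip: "L-lipschitz_on {s..t} (\<lambda>r. r powr \<theta>)"
  proof (rule lipschitz_onI)
    show "0 \<le> L" using L[of s] st norm_ge_zero order_trans by (metis atLeastAtMost_iff order_refl)
    fix u v assume uv: "u \<in> {s..t}" "v \<in> {s..t}"
    have "norm (u powr \<theta> - v powr \<theta>) \<le> L * norm (u - v)"
      by (rule field_differentiable_bound[of "{s..t}" _ "\<lambda>r. \<theta> * r powr (\<theta> - 1)"])
        (use uv L pd in auto)
    then show "dist (u powr \<theta>) (v powr \<theta>) \<le> L * dist u v" by (simp add: dist_norm)
  qed
  have "absolutely_continuous_fun_on {t0..t} \<gamma>"
    using ac S st unfolding locally_absolutely_continuous_from_def by auto
  then have "absolutely_continuous_fun_on {s..t} \<gamma>"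
    by (rule absolutely_continuous_fun_on_subset) (use S st in auto)
  then have acg: "absolutely_continuous_fun_on {s..t} (\<lambda>r. r powr \<theta> * \<gamma> r)"
    by (rule absolutely_continuous_fun_on_lipschitz_mult[OF _ lip])
  show "t powr \<theta> * \<gamma> t - s powr \<theta> * \<gamma> s \<le> integral {s..t} ?p"
  proof (rule absolutely_continuous_fun_on_increment_le[OF st(2) acg])
    show "negligible N" using N(2) by (simp add: negligible_iff_null_sets)
    show "?p integrable_on {s..t}" using p by (rule set_lebesgue_integral_eq_integral(1))
    fix r assume r: "r \<in> {s..t} - N"
    then have "S \<le> r" "r \<notin> N" using st by auto
    then have "\<gamma> differentiable at r" using N(1) by blast
    then obtain D where "(\<gamma> has_real_derivative D) (at r)" by (auto simp: real_differentiable_def)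
    then have "((\<lambda>r. r powr \<theta> * \<gamma> r) has_real_derivative \<theta> * r powr (\<theta> - 1) * \<gamma> r + D * r powr \<theta>) (at r)"
      using r by (intro DERIV_mult pd) auto
    then have "((\<lambda>r. r powr \<theta> * \<gamma> r) has_real_derivative deriv (\<lambda>s. s powr \<theta> * \<gamma> s) r) (at r)"
      by (simp add: DERIV_imp_deriv)
    then show "\<exists>D. ((\<lambda>r. r powr \<theta> * \<gamma> r) has_real_derivative D) (at r within {s..t}) \<and> D \<le> ?p r"
      by (intro exI[of _ "deriv (\<lambda>s. s powr \<theta> * \<gamma> s) r"]) (auto intro: has_field_derivative_at_within)
  qed
qed

theorem theorem1p3:
  fixes \<Phi> U :: "'a::{real_inner, complete_space} \<Rightarrow> real"
    and grad\<Phi> gradU :: "'a \<Rightarrow> 'a"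
    and \<gamma> \<epsilon> :: "real \<Rightarrow> real"
    and x x' x'' :: "real \<Rightarrow> 'a"
    and t0 t1 \<theta> \<alpha> :: real
  assumes t0: "t0 > 0"
    and convex: "convex_on UNIV \<Phi>" "convex_on UNIV U"
    and C1: "C1_gradient \<Phi> grad\<Phi>" "C1_gradient U gradU"
    and bounded_below: "bdd_below (range \<Phi>)" "bdd_below (range U)"
    and argmin_\<Phi>: "argmin_set \<Phi> \<noteq> {}"
    and lipschitz: "lipschitz_on_bounded_sets grad\<Phi>" "lipschitz_on_bounded_sets gradU"
    and \<gamma>_pos: "\<And>t. t \<ge> t0 \<Longrightarrow> \<gamma> t > 0"
    and \<gamma>_ac: "locally_absolutely_continuous_from t0 \<gamma>"
    and \<gamma>_bounds: "\<exists>s\<ge>t0. \<exists>K1>0. \<exists>K2>0. AE t in lebesgue. t \<ge> s \<longrightarrow>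
           \<gamma> t \<ge> K1 / t \<and> \<gamma> differentiable at t \<and> deriv \<gamma> t \<le> K2 / t\<^sup>2"
    and \<epsilon>_pos: "\<And>t. t \<ge> t0 \<Longrightarrow> \<epsilon> t > 0"
    and \<epsilon>_ac: "locally_absolutely_continuous_from t0 \<epsilon>"
    and \<epsilon>_antimono: "antimono_on {t0..} \<epsilon>"
    and \<epsilon>_lim: "(\<epsilon> \<longlongrightarrow> 0) at_top"
    and t1: "t1 \<ge> t0"
    and \<theta>: "0 \<le> \<theta>" "\<theta> \<le> 1"
    and \<alpha>: "\<alpha> > 0" "\<theta> = 1 \<Longrightarrow> \<alpha> > 3"
    and \<gamma>_lower: "\<And>t. t \<ge> t1 \<Longrightarrow> \<gamma> t \<ge> \<alpha> / t powr \<theta>"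
    and \<gamma>_integral:
      "(\<lambda>t. max 0 (deriv (\<lambda>s. s powr \<theta> * \<gamma> s) t)) absolutely_integrable_on {t0..}"
    and x_C2: "\<And>t. t \<ge> t0 \<Longrightarrow> (x has_vector_derivative x' t) (at t within {t0..})"
      "\<And>t. t \<ge> t0 \<Longrightarrow> (x' has_vector_derivative x'' t) (at t within {t0..})"
      "continuous_on {t0..} x''"
    and ode: "\<And>t. t \<ge> t0 \<Longrightarrow>
           x'' t + \<gamma> t *\<^sub>R x' t + grad\<Phi> (x t) + \<epsilon> t *\<^sub>R gradU (x t) = 0"
  shows "((\<lambda>t. t powr \<theta> * \<epsilon> t) absolutely_integrable_on {t0..} \<longrightarrow>
            (\<exists>z \<in> argmin_set \<Phi>. converges_weakly x z) \<and>
            energy \<Phi> U \<epsilon> x x' \<in> o[at_top](\<lambda>t. 1 / t powr (1 + \<theta>)) \<and>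
            (\<lambda>t. t powr \<theta> * energy \<Phi> U \<epsilon> x x' t) absolutely_integrable_on {t0..})
       \<and> (argmin_set \<Phi> \<inter> argmin_set U \<noteq> {} \<and>
          Liminf at_top (\<lambda>t. ereal (t powr (1 + \<theta>) * \<epsilon> t)) > 0 \<longrightarrow>
            (\<exists>z \<in> argmin_set \<Phi> \<inter> argmin_set U. converges_weakly x z) \<and>
            energy \<Phi> U \<epsilon> x x' \<in> o[at_top](\<lambda>t. 1 / t powr (1 + \<theta>)) \<and>
            (\<lambda>t. t powr \<theta> * energy \<Phi> U \<epsilon> x x' t) absolutely_integrable_on {t0..})"
proof -
  obtain s where s: "t0 \<le> s" and AE_s: "AE t in lebesgue. s \<le> t \<longrightarrow> \<gamma> differentiable at t"
  proof -
    obtain s K1 K2 where "t0 \<le> s" "AE t in lebesgue. s \<le> t \<longrightarrow>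
        K1 / t \<le> \<gamma> t \<and> \<gamma> differentiable at t \<and> deriv \<gamma> t \<le> K2 / t\<^sup>2"
      using \<gamma>_bounds by blast
    then show thesis by (intro that[of s]) (auto elim: AE_mp)
  qed
  \<comment> \<open>The start \<open>T\<close> lies beyond 1, beyond \<open>t1\<close> for the lower
    bound on \<open>\<gamma>\<close>, and beyond \<open>s\<close> for its almost everywhere
    differentiability.\<close>
  define T where "T = max 1 (max t1 s)"
  define p where "p = (\<lambda>t. max 0 (deriv (\<lambda>s. s powr \<theta> * \<gamma> s) t))"
  have T: "1 \<le> T" "t1 \<le> T" "s \<le> T" "t0 \<le> T" using t1 unfolding T_def by auto
  have sub: "{T..} \<subseteq> {t0..}" using T by auto
  have p_int: "p absolutely_integrable_on {T..}"
    unfolding p_def by (rule set_integrable_subset[OF \<gamma>_integral]) (use sub in auto)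
  have p_inc: "increment_le T (\<lambda>t. t powr \<theta> * \<gamma> t) p"
    unfolding p_def
  proof (rule powr_mult_increment_le[OF t0 \<gamma>_ac T(4)])
    show "AE t in lebesgue. T \<le> t \<longrightarrow> \<gamma> differentiable at t"
      using AE_s by eventually_elim (use T in auto)
  qed (use p_int in \<open>simp add: p_def\<close>)
  have \<epsilon>_cont_t0: "continuous_on {t0..} \<epsilon>"
    by (rule locally_absolutely_continuous_imp_continuous_on[OF \<epsilon>_ac])
  interpret damped_trajectory \<Phi> U grad\<Phi> gradU \<gamma> \<epsilon> p x x' x'' T \<theta> \<alpha>
  proof
    show "continuous_on {T..} \<gamma>" "continuous_on {T..} \<epsilon>" "continuous_on {T..} x''"
      using locally_absolutely_continuous_imp_continuous_on[OF \<gamma>_ac] \<epsilon>_cont_t0 x_C2(3) sub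
      by (auto intro: continuous_on_subset)
    show "\<epsilon> v \<le> \<epsilon> u" if "T \<le> u" "u \<le> v" for u v
      using monotone_onD[OF \<epsilon>_antimono, of u v] that T by auto
    show "(x has_vector_derivative x' t) (at t within {T..})"
      "(x' has_vector_derivative x'' t) (at t within {T..})" if "T \<le> t" for t
      using x_C2(1,2)[of t] that T sub by (auto intro: has_vector_derivative_within_subset)
    show "0 \<le> p t" for t by (simp add: p_def)
  qed (use assms T p_int p_inc in auto)
  \<comment> \<open>The locale speaks of times from \<open>T\<close> on. Continuity from
    \<open>t0\<close> extends the integrability of the weighted energy over the compact interval
    \<open>[t0, T]\<close>.\<close>
  have W_cont: "continuous_on {t0..} (\<lambda>t. t powr \<theta> * energy \<Phi> U \<epsilon> x x' t)"
  proof -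
    have "continuous_on {t0..} x" "continuous_on {t0..} x'"
      using x_C2(1,2) by (auto intro!: continuous_on_vector_derivative)
    moreover have "continuous_on {t0..} (\<lambda>t. \<Phi> (x t))" "continuous_on {t0..} (\<lambda>t. U (x t))"
      using calculation(1) C1[THEN C1_gradient_continuous_on]
      by (auto intro: continuous_on_compose2)
    ultimately show ?thesis unfolding energy_def using t0 \<epsilon>_cont_t0
      by (intro continuous_intros) auto
  qed
  note extend = absolutely_integrable_Ici_extend[OF W_cont]
  show ?thesis
  proof (intro conjI impI)
    assume "(\<lambda>t. t powr \<theta> * \<epsilon> t) absolutely_integrable_on {t0..}"
    then have "(\<lambda>t. t powr \<theta> * \<epsilon> t) absolutely_integrable_on {T..}"
      by (rule set_integrable_subset) (use sub in auto)
    note P1 = converges_if_\<epsilon>_integrable[OF argmin_\<Phi> this]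
    then show "\<exists>z\<in>argmin_set \<Phi>. converges_weakly x z" "W \<in> o(\<lambda>t. 1 / t powr (1 + \<theta>))"
      "(\<lambda>t. t powr \<theta> * W t) absolutely_integrable_on {t0..}"
      using extend by blast+
  next
    assume H: "argmin_set \<Phi> \<inter> argmin_set U \<noteq> {} \<and>
      Liminf at_top (\<lambda>t. ereal (t powr (1 + \<theta>) * \<epsilon> t)) > 0"
    note P2 = converges_if_\<epsilon>_liminf_pos[OF conjunct1[OF H] conjunct2[OF H]]
    then show "\<exists>z\<in>argmin_set \<Phi> \<inter> argmin_set U. converges_weakly x z"
      "W \<in> o(\<lambda>t. 1 / t powr (1 + \<theta>))"
      "(\<lambda>t. t powr \<theta> * W t) absolutely_integrable_on {t0..}"
      using extend by blast+
  qed
qed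

end
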